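(* For every $m\in\mathbb{N}_0$ and every real $x>0$ (in the sense of the Fourier–Legendre expansion on $(0,1)$), $$\frac{\log^m(x)}{\sqrt{x}}=(-1)^m m!\,2^{m+1}\sum_{k=0}^m\sum_{n=0}^\infty(-1)^n t_n(1_k)\,t^\star_{n+1}(1_{m-k})\,P_n(2x-1).$$
   Context: $P_n$ is the $n$-th Legendre polynomial. For a composition $\mathbf{k}=(k_1,\dots,k_r)$ and $n\in\mathbb{N}_0$: $t_n(\mathbf{k})=\sum_{n\ge n_1>\cdots>n_r>0}\prod_j(2n_j-1)^{-k_j}$ and $t^\star_n(\mathbf{k})=\sum_{n\ge n_1\ge\cdots\ge n_r>0}\prod_j(2n_j-1)^{-k_j}$, with value $1$ on the empty composition and empty sums equal to $0$. $1_k$ is the string of $k$ ones.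
   Formalization: The identity is stated for 0 < x < 1, together with the Fourier–Legendre coefficient formula on (0,1), rather than for every real x > 0, because the series diverges for x ≥ 1 (for example m = 0, x = 1 gives 2Σ(−1)^n). *)

theory Defs
  imports "HOL-Analysis.Analysis" "HOL-Computational_Algebra.Polynomial"
begin

text \<open>The Legendre polynomial of degree \<open>n\<close> on \<open>[-1, 1]\<close>, by Rodrigues' formula.\<close>

definition legendre :: "nat \<Rightarrow> real poly" where
  "legendre n = smult (1 / (2 ^ n * fact n)) ((pderiv ^^ n) ([:-1, 0, 1:] ^ n))"

text \<open>
  Compositions are lists of (positive) exponents. The index tuples \<open>(n\<^sub>1, \<dots>, n\<^sub>r)\<close> are
  lists with entries in \<open>{1..n}\<close>, strictly resp. weakly decreasing. For the empty
  composition the only index list is \<open>[]\<close>, which contributes the empty product 1.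
\<close>

definition t_sum :: "nat \<Rightarrow> nat list \<Rightarrow> real" where
  "t_sum n ks =
     (\<Sum>ns | length ns = length ks \<and> set ns \<subseteq> {1..n} \<and> sorted_wrt (>) ns.
        \<Prod>j<length ks. 1 / (2 * real (ns ! j) - 1) ^ (ks ! j))"

definition t_star_sum :: "nat \<Rightarrow> nat list \<Rightarrow> real" where
  "t_star_sum n ks =
     (\<Sum>ns | length ns = length ks \<and> set ns \<subseteq> {1..n} \<and> sorted_wrt (\<ge>) ns.
        \<Prod>j<length ks. 1 / (2 * real (ns ! j) - 1) ^ (ks ! j))"

lemma finite_t_sum_index:
  "finite {ns. length ns = r \<and> set ns \<subseteq> {1..n::nat} \<and> sorted_wrt R ns}"
  by (rule finite_subset[OF _ finite_lists_length_eq[of "{1..n}" r]]) auto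

lemma t_sum_Nil [simp]: "t_sum n [] = 1" and t_star_sum_Nil [simp]: "t_star_sum n [] = 1"
proof -
  have "{ns. length ns = length ([] :: nat list) \<and> set ns \<subseteq> {1..n} \<and> sorted_wrt R ns} = {[]}" for R
    by auto
  then show "t_sum n [] = 1" "t_star_sum n [] = 1"
    by (simp_all add: t_sum_def t_star_sum_def)
qed

text \<open>
  Coefficients with respect to the shifted Legendre polynomials \<open>P\<^sub>n(2x - 1)\<close>, which are
  orthogonal on \<open>(0, 1)\<close> with squared norm \<open>1 / (2n + 1)\<close>. The Lebesgue integral is 0 by
  convention when the integrand is not integrable, so integrability has to be stated separately.
\<close>

definition fourier_legendre_coeff :: "(real \<Rightarrow> real) \<Rightarrow> nat \<Rightarrow> real" where
  "fourier_legendre_coeff f n =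
     (2 * real n + 1) * (LBINT x:{0<..<1}. f x * poly (legendre n) (2 * x - 1))"

end

theory Submission
  imports Defs "HOL-Computational_Algebra.Computational_Algebra"
begin

text \<open>
  The Mellin transform of \<open>P\<^sub>n(2x - 1)\<close> on \<open>(0, 1)\<close> is
  \<open>(\<Prod>j<n. s - 1 - j) / (\<Prod>j\<le>n. s + j)\<close>, by the three-term recurrence. Its Taylor coefficients at
  \<open>s = 1/2\<close> are, up to factorials, the integrals of \<open>ln x ^ m / sqrt x * P\<^sub>n(2x - 1)\<close>; expanding numerator and
  denominator separately gives the generating functions of the sums \<open>t\<^sub>n(1\<^sub>k)\<close> and \<open>t\<^sup>\<star>\<^sub>n\<^sub>+\<^sub>1(1\<^sub>k)\<close>.

  For convergence, the partial sums of \<open>(-1)\<^sup>n (2n + 1) P\<^sub>n\<close> have a closed form, which Bernstein's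
  bound \<open>(1 - y\<^sup>2) P\<^sub>n(y)\<^sup>2 \<le> 2 / (n + 1)\<close> shows to be \<open>O(sqrt n)\<close> away from the end points. Since the
  coefficients grow only polylogarithmically, summation by parts yields uniform convergence on \<open>[0, 1]\<close>
  after multiplication by \<open>x\<^sup>2 (1 - x)\<close>. The limit has the same moments as
  \<open>ln x ^ m / sqrt x * x\<^sup>2 (1 - x)\<close>, so the two continuous functions agree by Weierstrass' theorem.
\<close>

section \<open>Legendre polynomials\<close>

text \<open>Leibniz' rule: only two terms survive, as the second derivative of the factor
  \<open>[:0, 1:]\<close> is 0.\<close>

lemma higher_pderiv_X_times:
  fixes p :: "real poly"
  shows "(pderiv ^^ Suc n) ([:0, 1:] * p) =
    [:0, 1:] * (pderiv ^^ Suc n) p + smult (real (Suc n)) ((pderiv ^^ n) p)"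
proof (induction n)
  case 0
  show ?case by (simp add: pderiv_mult pderiv_pCons)
next
  case (Suc n)
  have "(pderiv ^^ Suc (Suc n)) ([:0, 1:] * p) = pderiv ((pderiv ^^ Suc n) ([:0, 1:] * p))"
    by simp
  also have "\<dots> = pderiv ([:0, 1:] * (pderiv ^^ Suc n) p + smult (real (Suc n)) ((pderiv ^^ n) p))"
    by (simp only: Suc.IH)
  also have "\<dots> = [:0, 1:] * (pderiv ^^ Suc (Suc n)) p +
      (smult 1 ((pderiv ^^ Suc n) p) + smult (real (Suc n)) ((pderiv ^^ Suc n) p))"
    by (simp add: pderiv_mult pderiv_add pderiv_smult pderiv_pCons)
  also have "\<dots> = [:0, 1:] * (pderiv ^^ Suc (Suc n)) p + smult (real (Suc (Suc n))) ((pderiv ^^ Suc n) p)"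
    by (simp only: smult_add_left[symmetric]) simp
  finally show ?case .
qed

text \<open>Rodrigues' formula for degree n + 1 with one differentiation left out. Eliminating this
  polynomial from the next two identities gives the three-term recurrence; differentiating them
  gives the derivative formulas.\<close>

definition legendre_prim :: "nat \<Rightarrow> real poly" where
  "legendre_prim n = smult (1 / (2 ^ Suc n * fact (Suc n))) ((pderiv ^^ n) ([:-1, 0, 1:] ^ Suc n))"

lemma pderiv_legendre_prim: "pderiv (legendre_prim n) = legendre (Suc n)"
  by (simp add: legendre_prim_def legendre_def pderiv_smult)

lemma legendre_0: "legendre 0 = 1"
  by (simp add: legendre_def)

lemma legendre_1: "legendre (Suc 0) = [:0, 1:]"
  by (simp add: legendre_def pderiv_pCons)

lemma pderiv_base_power:
  "pderiv ([:-1, 0, 1:] ^ Suc n :: real poly) = smult (2 * real (Suc n)) ([:0, 1:] * [:-1, 0, 1:] ^ n)"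
proof -
  have "pderiv [:-1, 0, 1:] = smult 2 [:0, 1 :: real:]"
    by (simp add: pderiv_pCons)
  then show ?thesis
    by (simp only: pderiv_power_Suc mult_smult_left mult_smult_right smult_smult mult.commute)
qed

text \<open>The innermost differentiation brings out a factor \<open>[:0, 1:]\<close>, and Leibniz'
  rule then handles the remaining ones.\<close>

lemma legendre_Suc_Suc_prim:
  "legendre (Suc (Suc n)) = [:0, 1:] * legendre (Suc n) + smult (real (Suc n)) (legendre_prim n)"
proof -
  have "(pderiv ^^ Suc (Suc n)) ([:-1, 0, 1:] ^ Suc (Suc n) :: real poly)
      = (pderiv ^^ Suc n) (pderiv ([:-1, 0, 1:] ^ Suc (Suc n)))"
    by (simp only: funpow_Suc_right o_apply)
  also have "\<dots> = smult (2 * real (Suc (Suc n))) ((pderiv ^^ Suc n) ([:0, 1:] * [:-1, 0, 1:] ^ Suc n))"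
    by (simp only: pderiv_base_power higher_pderiv_smult)
  also have "\<dots> = smult (2 * real (Suc (Suc n))) ([:0, 1:] * (pderiv ^^ Suc n) ([:-1, 0, 1:] ^ Suc n)
       + smult (real (Suc n)) ((pderiv ^^ n) ([:-1, 0, 1:] ^ Suc n)))"
    by (simp only: higher_pderiv_X_times)
  finally have E: "(pderiv ^^ Suc (Suc n)) ([:-1, 0, 1:] ^ Suc (Suc n) :: real poly) = \<dots>" .
  have c: "1 / (2 ^ Suc (Suc n) * fact (Suc (Suc n))) * (2 * real (Suc (Suc n))) = 1 / (2 ^ Suc n * fact (Suc n) :: real)"
    by (simp add: divide_simps)
  have *: "smult d' (smult e (x * A + smult s B)) = x * smult d A + smult s (smult d B)"
    if "d' * e = d" for d d' e s :: real and x A B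
    by (simp add: smult_add_right that[symmetric] mult_ac)
  show ?thesis
    unfolding legendre_def E legendre_prim_def by (rule *[OF c])
qed

text \<open>Here the two innermost differentiations are carried out; replacing X^2 by (X^2 - 1) + 1
  leaves a combination of two consecutive powers of X^2 - 1.\<close>

lemma legendre_Suc_Suc_diff:
  "legendre (Suc (Suc n)) = legendre n + smult (2 * real n + 3) (legendre_prim n)"
proof -
  let ?q = "[:-1, 0, 1:] :: real poly"
  have q: "[:0, 1:] * [:0, 1:] = ?q + 1" by (simp add: one_pCons)
  have 1: "pderiv ([:0, 1:] * ?q ^ Suc n) = smult (2 * real n + 3) (?q ^ Suc n) + smult (2 * real (Suc n)) (?q ^ n)"
  proof -
    have "pderiv ([:0, 1:] * ?q ^ Suc n) = ?q ^ Suc n + smult (2 * real (Suc n)) (([:0, 1:] * [:0, 1:]) * ?q ^ n)"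
      by (simp only: pderiv_mult pderiv_base_power)
         (simp add: pderiv_pCons mult.assoc mult.left_commute)
    also have "\<dots> = ?q ^ Suc n + smult (2 * real (Suc n)) (?q ^ Suc n + ?q ^ n)"
      by (simp only: q) (simp add: algebra_simps)
    also have "\<dots> = smult (2 * real n + 3) (?q ^ Suc n) + smult (2 * real (Suc n)) (?q ^ n)"
    proof -
      have "smult (2 * real n + 3) (?q ^ Suc n) = ?q ^ Suc n + smult (2 * real (Suc n)) (?q ^ Suc n)"
        using smult_add_left[of 1 "2 * real (Suc n)" "?q ^ Suc n"] by (simp add: algebra_simps)
      then show ?thesis by (simp only: smult_add_right add.assoc)
    qed
    finally show ?thesis .
  qed
  have "(pderiv ^^ Suc (Suc n)) (?q ^ Suc (Suc n)) = (pderiv ^^ n) (pderiv (pderiv (?q ^ Suc (Suc n))))"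
    by (simp only: funpow_Suc_right o_apply)
  also have "\<dots> = smult (2 * real (Suc (Suc n))) ((pderiv ^^ n) (pderiv ([:0, 1:] * ?q ^ Suc n)))"
    by (simp only: pderiv_base_power pderiv_smult higher_pderiv_smult)
  also have "\<dots> = smult (2 * real (Suc (Suc n))) (smult (2 * real n + 3) ((pderiv ^^ n) (?q ^ Suc n))
       + smult (2 * real (Suc n)) ((pderiv ^^ n) (?q ^ n)))"
    by (simp only: 1 higher_pderiv_add higher_pderiv_smult)
  finally have E: "(pderiv ^^ Suc (Suc n)) (?q ^ Suc (Suc n)) = \<dots>" .
  have c: "1 / (2 ^ Suc (Suc n) * fact (Suc (Suc n))) * (2 * real (Suc (Suc n))) = 1 / (2 ^ Suc n * fact (Suc n) :: real)"
    "1 / (2 ^ Suc n * fact (Suc n)) * (2 * real (Suc n)) = 1 / (2 ^ n * fact n :: real)"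
    by (simp_all add: divide_simps)
  have *: "smult d'' (smult e' (smult s A + smult e B)) = smult d B + smult s (smult d' A)"
    if "d'' * e' = d'" "d' * e = d" for d d' d'' e e' s :: real and A B
    by (simp add: smult_add_right that[symmetric] mult_ac)
  show ?thesis
    unfolding legendre_def E legendre_prim_def by (rule *[OF c])
qed

lemma poly_legendre_recurrence:
  "(real n + 2) * poly (legendre (Suc (Suc n))) y =
     (2 * real n + 3) * y * poly (legendre (Suc n)) y - (real n + 1) * poly (legendre n) y"
proof -
  have a: "poly (legendre (Suc (Suc n))) y = y * poly (legendre (Suc n)) y + (real n + 1) * poly (legendre_prim n) y"
    by (subst legendre_Suc_Suc_prim) (simp add: algebra_simps)
  have b: "poly (legendre (Suc (Suc n))) y = poly (legendre n) y + (2 * real n + 3) * poly (legendre_prim n) y"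
    by (subst legendre_Suc_Suc_diff) (simp add: algebra_simps)
  show ?thesis using a b by algebra
qed

lemma poly_pderiv_legendre_raise:
  "poly (pderiv (legendre (Suc n))) y = (real n + 1) * poly (legendre n) y + y * poly (pderiv (legendre n)) y"
proof (cases n)
  case 0
  then show ?thesis by (simp add: legendre_0 legendre_1 pderiv_pCons)
next
  case (Suc k)
  show ?thesis unfolding Suc
    by (subst legendre_Suc_Suc_prim)
       (simp add: pderiv_mult pderiv_add pderiv_smult pderiv_legendre_prim pderiv_pCons algebra_simps)
qed

text \<open>Two expressions for the derivative of \<open>legendre (Suc (Suc n))\<close> are
  compared: one from \<open>legendre_Suc_Suc_diff\<close>, one from the raising formula.\<close>

lemma poly_pderiv_legendre_lower:
  "poly (pderiv (legendre n)) y = y * poly (pderiv (legendre (Suc n))) y - (real n + 1) * poly (legendre (Suc n)) y"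
proof -
  have "poly (pderiv (legendre (Suc (Suc n)))) y = poly (pderiv (legendre n)) y + (2 * real n + 3) * poly (legendre (Suc n)) y"
    by (subst legendre_Suc_Suc_diff) (simp add: pderiv_add pderiv_smult pderiv_legendre_prim)
  moreover have "poly (pderiv (legendre (Suc (Suc n)))) y = (real n + 2) * poly (legendre (Suc n)) y + y * poly (pderiv (legendre (Suc n))) y"
    using poly_pderiv_legendre_raise[of "Suc n" y] by (simp add: algebra_simps)
  ultimately show ?thesis by (simp add: algebra_simps)
qed

section \<open>Bernstein's bound and the alternating sum\<close>

text \<open>At 0 the middle term of the recurrence drops out, so values two degrees apart differ by
  the factor -(n + 1)/(n + 2); the induction closes because (n + 1)(n + 3) <= (n + 2)^2.\<close>

lemma legendre_at_0_bound: "(real n + 1) * (poly (legendre n) 0)\<^sup>2 \<le> 1"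
proof (induction n rule: induct_nat_012)
  case (ge2 n)
  let ?a = "poly (legendre n) 0" and ?b = "poly (legendre (Suc (Suc n))) 0"
  have "(real n + 2) * ?b = - (real n + 1) * ?a"
    using poly_legendre_recurrence[of n 0] by (simp add: algebra_simps)
  then have b: "?b = - (real n + 1) * ?a / (real n + 2)"
    by (simp add: field_simps)
  have "(real n + 3) * ?b\<^sup>2 = ((real n + 3) * (real n + 1) / (real n + 2)\<^sup>2) * ((real n + 1) * ?a\<^sup>2)"
    unfolding b by (simp add: field_simps power2_eq_square)
  also have "\<dots> \<le> 1 * 1"
  proof (rule mult_mono)
    show "(real n + 3) * (real n + 1) / (real n + 2)\<^sup>2 \<le> 1"
      by (simp add: divide_simps power2_eq_square) (simp add: algebra_simps)
  qed (use ge2 in auto)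
  finally show ?case by (simp add: algebra_simps)
qed (simp_all add: legendre_0 legendre_1)

text \<open>An auxiliary function \<open>D\<close> of two consecutive Legendre polynomials dominates
  a multiple of the left-hand side and is largest at 0, where \<open>legendre_at_0_bound\<close>
  controls it.\<close>

lemma legendre_bound:
  assumes y: "-1 \<le> y" "y \<le> 1"
  shows "(1 - y\<^sup>2) * (poly (legendre n) y)\<^sup>2 \<le> 2 / (real n + 1)"
proof (cases n)
  case 0
  have "1 - y\<^sup>2 \<le> 2" using zero_le_power2[of y] by linarith
  then show ?thesis by (simp add: 0 legendre_0)
next
  case (Suc k)
  define N where "N = real k + 1"
  have N: "N > 0" by (simp add: N_def)
  define P where "P = (\<lambda>y. poly (legendre (Suc k)) y)"
  define Q where "Q = (\<lambda>y. poly (legendre k) y)"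
  define P' where "P' = (\<lambda>y. poly (pderiv (legendre (Suc k))) y)"
  define Q' where "Q' = (\<lambda>y. poly (pderiv (legendre k)) y)"
  \<comment> \<open>The derivatives of \<open>P\<close> and \<open>Q\<close> cancel in \<open>D'\<close>, leaving \<open>- 2 y N (N + 1) P\<^sup>2\<close>: so \<open>D\<close> is maximal at 0.\<close>
  define D where "D = (\<lambda>y. N\<^sup>2 * ((P y)\<^sup>2 - 2 * y * P y * Q y + (Q y)\<^sup>2) + N * (1 - y\<^sup>2) * (P y)\<^sup>2)"
  have up: "P' y = N * Q y + y * Q' y" for y
    unfolding P_def Q_def P'_def Q'_def N_def by (rule poly_pderiv_legendre_raise)
  have dn: "Q' y = y * P' y - N * P y" for y
    unfolding P_def Q_def P'_def Q'_def N_def by (rule poly_pderiv_legendre_lower)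
  have dP: "(P has_real_derivative P' y) (at y)" for y
    unfolding P_def P'_def by (rule poly_DERIV)
  have dQ: "(Q has_real_derivative Q' y) (at y)" for y
    unfolding Q_def Q'_def by (rule poly_DERIV)
  have dD: "(D has_real_derivative (- 2 * y * N * (N + 1) * (P y)\<^sup>2)) (at y)" for y
  proof -
    have "(D has_real_derivative (N\<^sup>2 * (2 * P y * P' y - 2 * (P y * Q y + y * P' y * Q y + y * P y * Q' y)
       + 2 * Q y * Q' y) + N * (- 2 * y * (P y)\<^sup>2 + (1 - y\<^sup>2) * 2 * P y * P' y))) (at y)"
      unfolding D_def
      by (rule derivative_eq_intros dP dQ refl)+ (simp add: algebra_simps power2_eq_square)
    moreover have "N\<^sup>2 * (2 * P y * P' y - 2 * (P y * Q y + y * P' y * Q y + y * P y * Q' y)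
       + 2 * Q y * Q' y) + N * (- 2 * y * (P y)\<^sup>2 + (1 - y\<^sup>2) * 2 * P y * P' y)
       = - 2 * y * N * (N + 1) * (P y)\<^sup>2"
      using up[of y] dn[of y] by algebra
    ultimately show ?thesis by simp
  qed
  have "D y \<le> D 0"
  proof (cases "y \<ge> 0")
    case True
    show ?thesis
      by (rule DERIV_nonpos_imp_nonincreasing[OF True]) (use dD N in \<open>auto intro!: exI mult_nonneg_nonneg\<close>)
  next
    case False
    show ?thesis
      by (rule DERIV_nonneg_imp_nondecreasing[of y 0 D])
         (use False dD N in \<open>auto intro!: exI mult_nonneg_nonneg mult_nonpos_nonneg\<close>)
  qed
  also have "D 0 = N * ((N + 1) * (P 0)\<^sup>2) + N * (N * (Q 0)\<^sup>2)"
    unfolding D_def by (simp add: algebra_simps power2_eq_square)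
  also have "\<dots> \<le> N * 1 + N * 1"
    using legendre_at_0_bound[of "Suc k"] legendre_at_0_bound[of k] N
    by (intro add_mono mult_left_mono) (auto simp: N_def P_def Q_def algebra_simps)
  finally have "D y \<le> 2 * N" by simp
  \<comment> \<open>Completing the square in \<open>Q y\<close> leaves exactly N (N + 1) times the
    quantity to be bounded.\<close>
  moreover have "D y = N\<^sup>2 * (Q y - y * P y)\<^sup>2 + N * (N + 1) * ((1 - y\<^sup>2) * (P y)\<^sup>2)"
    unfolding D_def by (simp add: algebra_simps power2_eq_square)
  moreover have "N\<^sup>2 * (Q y - y * P y)\<^sup>2 \<ge> 0" by simp
  ultimately have "N * (N + 1) * ((1 - y\<^sup>2) * (P y)\<^sup>2) \<le> 2 * N" by linarith
  then have "N * ((N + 1) * ((1 - y\<^sup>2) * (P y)\<^sup>2)) \<le> N * 2" by (simp only: mult.assoc mult.commute)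
  then have "(N + 1) * ((1 - y\<^sup>2) * (P y)\<^sup>2) \<le> 2" using N by simp
  then show ?thesis using N by (simp add: Suc P_def N_def field_simps)
qed

text \<open>This is the Christoffel-Darboux formula with second argument -1, where the k-th Legendre
  polynomial has the value (-1)^k.\<close>

lemma legendre_alternating_sum:
  "(1 + y) * (\<Sum>k\<le>N. (-1) ^ k * (2 * real k + 1) * poly (legendre k) y) =
     (-1) ^ N * (real N + 1) * (poly (legendre N) y + poly (legendre (Suc N)) y)"
proof (induction N)
  case (Suc N)
  have r: "(real N + 2) * poly (legendre (Suc (Suc N))) y =
     (2 * real N + 3) * y * poly (legendre (Suc N)) y - (real N + 1) * poly (legendre N) y"
    by (rule poly_legendre_recurrence)
  have "(1 + y) * (\<Sum>k\<le>Suc N. (-1) ^ k * (2 * real k + 1) * poly (legendre k) y) =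
     (-1) ^ N * ((real N + 1) * (poly (legendre N) y + poly (legendre (Suc N)) y)
       - (1 + y) * (2 * real N + 3) * poly (legendre (Suc N)) y)"
    using Suc.IH by (simp add: algebra_simps)
  also have "\<dots> = (-1) ^ N * (- ((real N + 2) * poly (legendre (Suc N)) y + (real N + 2) * poly (legendre (Suc (Suc N))) y))"
    unfolding r by (simp add: algebra_simps)
  finally show ?case by (simp add: algebra_simps)
qed (simp add: legendre_0 legendre_1)

section \<open>Generating functions of the multiple sums\<close>

lemma t_sum_ones:
  "t_sum n (replicate r 1) =
     (\<Sum>ns | length ns = r \<and> set ns \<subseteq> {1..n} \<and> sorted_wrt (>) ns. \<Prod>i\<leftarrow>ns. 1 / (2 * real i - 1))"
  unfolding t_sum_def by (auto intro!: sum.cong simp: prod.list_conv_set_nth atLeast0LessThan)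

lemma t_star_sum_ones:
  "t_star_sum n (replicate r 1) =
     (\<Sum>ns | length ns = r \<and> set ns \<subseteq> {1..n} \<and> sorted_wrt (\<ge>) ns. \<Prod>i\<leftarrow>ns. 1 / (2 * real i - 1))"
  unfolding t_star_sum_def by (auto intro!: sum.cong simp: prod.list_conv_set_nth atLeast0LessThan)

lemma t_sum_0_ones: "t_sum 0 (replicate (Suc r) 1) = 0"
  and t_star_sum_0_ones: "t_star_sum 0 (replicate (Suc r) 1) = 0"
proof -
  have "{ns. length ns = Suc r \<and> set ns \<subseteq> {1..0::nat} \<and> sorted_wrt R ns} = {}" for R
    by (auto simp: length_Suc_conv)
  then show "t_sum 0 (replicate (Suc r) 1) = 0" "t_star_sum 0 (replicate (Suc r) 1) = 0"
    unfolding t_sum_ones t_star_sum_ones by simp_all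
qed

text \<open>The index lists are split by whether they start with n + 1. By strictness the rest of
  such a list lies in \<open>{1..n}\<close>.\<close>

lemma t_sum_Suc_ones:
  "t_sum (Suc n) (replicate (Suc r) 1) =
     t_sum n (replicate (Suc r) 1) + t_sum n (replicate r 1) / (2 * real n + 1)"
proof -
  define I where "I = (\<lambda>n r. {ns. length ns = r \<and> set ns \<subseteq> {1..n::nat} \<and> sorted_wrt (>) ns})"
  have fin: "finite (I n r)" for n r
    unfolding I_def by (rule finite_t_sum_index)
  have sum_I: "t_sum n (replicate r 1) = (\<Sum>ns\<in>I n r. \<Prod>i\<leftarrow>ns. 1 / (2 * real i - 1))" for n r
    by (simp only: t_sum_ones I_def)
  have "I (Suc n) (Suc r) = I n (Suc r) \<union> (#) (Suc n) ` I n r" (is "?A = ?B")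
  proof (intro equalityI subsetI)
    fix ns assume "ns \<in> ?A"
    then obtain a l where ns: "ns = a # l" "length l = r" "1 \<le> a" "a \<le> Suc n"
        "set l \<subseteq> {1..Suc n}" "sorted_wrt (>) l" "\<forall>b\<in>set l. b < a"
      unfolding I_def by (cases ns) auto
    have l: "set l \<subseteq> {1..n}" using ns(4,5,7) by fastforce
    show "ns \<in> ?B"
      using ns l by (cases "a = Suc n") (auto simp: I_def)
  qed (fastforce simp: I_def)+
  moreover have "I n (Suc r) \<inter> (#) (Suc n) ` I n r = {}"
    by (auto simp: I_def)
  ultimately have "t_sum (Suc n) (replicate (Suc r) 1) = t_sum n (replicate (Suc r) 1)
      + (\<Sum>ns\<in>(#) (Suc n) ` I n r. \<Prod>i\<leftarrow>ns. 1 / (2 * real i - 1))"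
    unfolding sum_I by (simp add: sum.union_disjoint fin)
  also have "(\<Sum>ns\<in>(#) (Suc n) ` I n r. \<Prod>i\<leftarrow>ns. 1 / (2 * real i - 1))
      = (\<Sum>ns\<in>I n r. 1 / (2 * real n + 1) * (\<Prod>i\<leftarrow>ns. 1 / (2 * real i - 1)))"
    by (subst sum.reindex) (auto intro!: sum.cong)
  also have "\<dots> = t_sum n (replicate r 1) / (2 * real n + 1)"
    unfolding sum_I by (simp flip: sum_divide_distrib)
  finally show ?thesis .
qed

text \<open>The same splitting as for \<open>t_sum\<close>, but n + 1 may now be repeated, so the
  tail still ranges up to n + 1.\<close>

lemma t_star_sum_Suc_ones:
  "t_star_sum (Suc n) (replicate (Suc r) 1) =
     t_star_sum n (replicate (Suc r) 1) + t_star_sum (Suc n) (replicate r 1) / (2 * real n + 1)"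
proof -
  define I where "I = (\<lambda>n r. {ns. length ns = r \<and> set ns \<subseteq> {1..n::nat} \<and> sorted_wrt (\<ge>) ns})"
  have fin: "finite (I n r)" for n r
    unfolding I_def by (rule finite_t_sum_index)
  have sum_I: "t_star_sum n (replicate r 1) = (\<Sum>ns\<in>I n r. \<Prod>i\<leftarrow>ns. 1 / (2 * real i - 1))" for n r
    by (simp only: t_star_sum_ones I_def)
  have "I (Suc n) (Suc r) = I n (Suc r) \<union> (#) (Suc n) ` I (Suc n) r" (is "?A = ?B")
  proof (intro equalityI subsetI)
    fix ns assume "ns \<in> ?A"
    then obtain a l where ns: "ns = a # l" "length l = r" "1 \<le> a" "a \<le> Suc n"
        "set l \<subseteq> {1..Suc n}" "sorted_wrt (\<ge>) l" "\<forall>b\<in>set l. b \<le> a"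
      unfolding I_def by (cases ns) auto
    show "ns \<in> ?B"
    proof (cases "a = Suc n")
      case False
      then have "set l \<subseteq> {1..n}" using ns(4,5,7) by fastforce
      then show ?thesis using ns False by (auto simp: I_def)
    qed (use ns in \<open>auto simp: I_def\<close>)
  qed (fastforce simp: I_def)+
  moreover have "I n (Suc r) \<inter> (#) (Suc n) ` I (Suc n) r = {}"
    by (auto simp: I_def)
  ultimately have "t_star_sum (Suc n) (replicate (Suc r) 1) = t_star_sum n (replicate (Suc r) 1)
      + (\<Sum>ns\<in>(#) (Suc n) ` I (Suc n) r. \<Prod>i\<leftarrow>ns. 1 / (2 * real i - 1))"
    unfolding sum_I by (simp add: sum.union_disjoint fin)
  also have "(\<Sum>ns\<in>(#) (Suc n) ` I (Suc n) r. \<Prod>i\<leftarrow>ns. 1 / (2 * real i - 1))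
      = (\<Sum>ns\<in>I (Suc n) r. 1 / (2 * real n + 1) * (\<Prod>i\<leftarrow>ns. 1 / (2 * real i - 1)))"
    by (subst sum.reindex) (auto intro!: sum.cong)
  also have "\<dots> = t_star_sum (Suc n) (replicate r 1) / (2 * real n + 1)"
    unfolding sum_I by (simp flip: sum_divide_distrib)
  finally show ?thesis .
qed

section \<open>Product formulas for the generating functions\<close>

text \<open>The weights (-2)^k make this the product of 1 - X / (j + 1/2) over j < n, because 1 / (j
  + 1/2) = 2 / (2j + 1). Likewise \<open>t_star_fps n\<close> is the product of the inverses of 1 +
  X / (j + 1/2).\<close>

definition t_fps :: "nat \<Rightarrow> real fps" where
  "t_fps n = Abs_fps (\<lambda>k. (-2) ^ k * t_sum n (replicate k 1))"

definition t_star_fps :: "nat \<Rightarrow> real fps" where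
  "t_star_fps n = Abs_fps (\<lambda>k. (-2) ^ k * t_star_sum n (replicate k 1))"

lemma t_fps_0: "t_fps 0 = 1"
  by (rule fps_ext, rename_tac k, case_tac k)
     (simp_all add: t_fps_def t_sum_0_ones del: replicate_Suc One_nat_def)

lemma t_star_fps_0: "t_star_fps 0 = 1"
  by (rule fps_ext, rename_tac k, case_tac k)
     (simp_all add: t_star_fps_def t_star_sum_0_ones del: replicate_Suc One_nat_def)

lemma t_fps_Suc:
  "fps_const (real n + 1/2) * t_fps (Suc n) = - (t_fps n * (fps_X - fps_const (1/2 + real n)))"
proof (rule fps_ext)
  fix k show "(fps_const (real n + 1/2) * t_fps (Suc n)) $ k = (- (t_fps n * (fps_X - fps_const (1/2 + real n)))) $ k"
    by (cases k) (simp_all add: t_fps_def t_sum_Suc_ones right_diff_distrib field_simps del: replicate_Suc One_nat_def)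
qed

lemma t_star_fps_Suc:
  "t_star_fps (Suc n) * (fps_X + fps_const (1/2 + real n)) = fps_const (real n + 1/2) * t_star_fps n"
proof (rule fps_ext)
  fix k show "(t_star_fps (Suc n) * (fps_X + fps_const (1/2 + real n))) $ k = (fps_const (real n + 1/2) * t_star_fps n) $ k"
    by (cases k) (simp_all add: t_star_fps_def t_star_sum_Suc_ones distrib_left field_simps del: replicate_Suc One_nat_def)
qed

text \<open>With denominators cleared, the product takes the shape of the numerator of the Mellin
  transform at 1/2 + z; \<open>t_star_fps_prod\<close> does the same for the denominator.\<close>

lemma t_fps_prod:
  "t_fps n * fps_const (\<Prod>j<n. real j + 1/2) = (-1) ^ n * (\<Prod>j<n. fps_X - fps_const (1/2 + real j))"
proof (induction n)
  case (Suc n)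
  have "t_fps (Suc n) * fps_const (\<Prod>j<Suc n. real j + 1/2)
      = (fps_const (real n + 1/2) * t_fps (Suc n)) * fps_const (\<Prod>j<n. real j + 1/2)"
    by (simp add: mult_ac flip: fps_const_mult)
  also have "\<dots> = - ((t_fps n * fps_const (\<Prod>j<n. real j + 1/2)) * (fps_X - fps_const (1/2 + real n)))"
    unfolding t_fps_Suc mult_minus_left by (simp only: mult_ac)
  finally show ?case by (simp add: Suc.IH mult_ac)
qed (simp add: t_fps_0)

lemma t_star_fps_prod:
  "t_star_fps n * (\<Prod>j<n. fps_X + fps_const (1/2 + real j)) = fps_const (\<Prod>j<n. real j + 1/2)"
proof (induction n)
  case (Suc n)
  have "t_star_fps (Suc n) * (\<Prod>j<Suc n. fps_X + fps_const (1/2 + real j))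
      = (t_star_fps (Suc n) * (fps_X + fps_const (1/2 + real n))) * (\<Prod>j<n. fps_X + fps_const (1/2 + real j))"
    by (simp only: prod.lessThan_Suc mult_ac)
  also have "\<dots> = fps_const (real n + 1/2) * (t_star_fps n * (\<Prod>j<n. fps_X + fps_const (1/2 + real j)))"
    by (simp only: t_star_fps_Suc mult_ac)
  finally show ?case by (simp add: Suc.IH mult_ac)
qed (simp add: t_star_fps_0)

section \<open>Moments of the shifted Legendre polynomials\<close>

text \<open>The geometric series of 1 / (c + X), which for c > 0 is the Mellin transform at c + X of
  the constant 1 on (0, 1).\<close>

definition inverse_linear_fps :: "real \<Rightarrow> real fps" where
  "inverse_linear_fps c = Abs_fps (\<lambda>m. (-1) ^ m / c ^ Suc m)"

lemma inverse_linear_fps_mult: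
  assumes "c \<noteq> 0"
  shows "inverse_linear_fps c * (fps_X + fps_const c) = 1"
proof (rule fps_ext)
  fix k show "(inverse_linear_fps c * (fps_X + fps_const c)) $ k = 1 $ k"
    using assms by (cases k) (simp_all add: inverse_linear_fps_def distrib_left)
qed

text \<open>
  The coefficient of \<open>z\<^sup>m\<close> is \<open>1 / m!\<close> times the integral of \<open>x powr (b - 1) * ln x ^ m * p x\<close> over
  \<open>(0, 1)\<close>; in other words, this is the Mellin transform of \<open>p\<close> on \<open>(0, 1)\<close> at \<open>b + z\<close>.
\<close>

definition moment_fps :: "real \<Rightarrow> real poly \<Rightarrow> real fps" where
  "moment_fps b p = (\<Sum>i\<le>degree p. fps_const (coeff p i) * inverse_linear_fps (b + real i))"

lemma moment_fps_altdef:
  assumes "degree p \<le> N"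
  shows "moment_fps b p = (\<Sum>i\<le>N. fps_const (coeff p i) * inverse_linear_fps (b + real i))"
  unfolding moment_fps_def
  by (rule sum.mono_neutral_left) (use assms in \<open>auto simp: coeff_eq_0\<close>)

lemma moment_fps_add: "moment_fps b (p + q) = moment_fps b p + moment_fps b q"
proof -
  define N where "N = max (degree p) (degree q)"
  have "degree p \<le> N" "degree q \<le> N" "degree (p + q) \<le> N"
    by (auto simp: N_def degree_add_le_max)
  then show ?thesis
    by (simp add: moment_fps_altdef sum.distrib distrib_right flip: fps_const_add)
qed

lemma moment_fps_smult: "moment_fps b (smult c p) = fps_const c * moment_fps b p"
proof -
  have "degree (smult c p) \<le> degree p" by (rule degree_smult_le)
  then show ?thesis
    by (simp add: moment_fps_altdef[of "smult c p" "degree p"] moment_fps_def sum_distrib_left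
        mult.assoc flip: fps_const_mult)
qed

lemma moment_fps_0: "moment_fps b 0 = 0"
  by (simp add: moment_fps_def)

lemma moment_fps_diff: "moment_fps b (p - q) = moment_fps b p - moment_fps b q"
proof -
  have "moment_fps b (p + smult (-1) q) = moment_fps b p + fps_const (-1) * moment_fps b q"
    by (simp only: moment_fps_add moment_fps_smult)
  then show ?thesis by (simp flip: fps_const_neg)
qed

lemma moment_fps_sum: "moment_fps b (\<Sum>i\<in>A. f i) = (\<Sum>i\<in>A. moment_fps b (f i))"
  by (induction A rule: infinite_finite_induct) (simp_all add: moment_fps_0 moment_fps_add)

text \<open>Under the integral a further factor x raises the exponent b - 1 by one.\<close>

lemma moment_fps_X_mult: "moment_fps b ([:0, 1:] * p) = moment_fps (b + 1) p"
proof -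
  have "degree ([:0, 1:] * p) \<le> Suc (degree p)"
    by (simp add: degree_pCons_le)
  then have "moment_fps b ([:0, 1:] * p) =
      (\<Sum>i\<le>Suc (degree p). fps_const (coeff ([:0, 1:] * p) i) * inverse_linear_fps (b + real i))"
    by (rule moment_fps_altdef)
  also have "\<dots> = moment_fps (b + 1) p"
    by (subst sum.atMost_Suc_shift) (simp add: moment_fps_def algebra_simps)
  finally show ?thesis .
qed

definition shifted_legendre :: "nat \<Rightarrow> real poly" where
  "shifted_legendre n = pcompose (legendre n) [:-1, 2:]"

lemma poly_shifted_legendre: "poly (shifted_legendre n) x = poly (legendre n) (2 * x - 1)"
  by (simp add: shifted_legendre_def poly_pcompose algebra_simps)

lemma shifted_legendre_0: "shifted_legendre 0 = 1"
  and shifted_legendre_1: "shifted_legendre (Suc 0) = [:-1, 2:]"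
  by (simp_all add: shifted_legendre_def legendre_0 legendre_1 pcompose_1 pcompose_pCons)

lemma shifted_legendre_recurrence:
  "smult (real n + 2) (shifted_legendre (Suc (Suc n))) =
     smult (2 * real n + 3) (smult 2 ([:0, 1:] * shifted_legendre (Suc n)) - shifted_legendre (Suc n))
     - smult (real n + 1) (shifted_legendre n)"
proof (rule iffD1[OF poly_eq_poly_eq_iff])
  show "poly (smult (real n + 2) (shifted_legendre (Suc (Suc n)))) =
    poly (smult (2 * real n + 3) (smult 2 ([:0, 1:] * shifted_legendre (Suc n)) - shifted_legendre (Suc n))
     - smult (real n + 1) (shifted_legendre n))"
    using poly_legendre_recurrence[of n "2 * x - 1" for x]
    by (auto simp: fun_eq_iff poly_shifted_legendre algebra_simps)
qed

lemma moment_shifted_legendre_recurrence: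
  "fps_const (real n + 2) * moment_fps b (shifted_legendre (Suc (Suc n))) =
     fps_const (2 * real n + 3) *
       (2 * moment_fps (b + 1) (shifted_legendre (Suc n)) - moment_fps b (shifted_legendre (Suc n)))
     - fps_const (real n + 1) * moment_fps b (shifted_legendre n)"
proof -
  have two: "fps_const 2 = (2 :: real fps)" by (simp add: numeral_fps_const)
  from arg_cong[OF shifted_legendre_recurrence, of "moment_fps b" n]
  show ?thesis
    by (simp only: moment_fps_smult moment_fps_diff moment_fps_X_mult two)
qed

text \<open>Induction along the three-term recurrence. Its factor x turns into the shift from
  \<open>b\<close> to \<open>b + 1\<close>, so \<open>b\<close> has to vary. The denominator is
  multiplied out, which turns the claim into a polynomial identity.\<close>

lemma moment_shifted_legendre:
  assumes "b > 0"
  shows "moment_fps b (shifted_legendre n) * (\<Prod>j\<le>n. fps_X + fps_const (b + real j)) =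
    (\<Prod>j<n. fps_X + fps_const (b - 1 - real j))"
  using assms
proof (induction n arbitrary: b rule: induct_nat_012)
  case 0
  then show ?case
    by (simp add: shifted_legendre_0 moment_fps_def inverse_linear_fps_mult)
next
  case 1
  define X where "X = (fps_X :: real fps)"
  define B where "B = fps_const b"
  have B1: "fps_const (b + 1) = B + 1" "fps_const (b - 1) = B - 1"
    by (simp_all add: B_def flip: fps_const_add fps_const_sub)
  define J where "J = inverse_linear_fps b"
  define K where "K = inverse_linear_fps (b + 1)"
  have J: "J * (X + B) = 1" and K: "K * (X + (B + 1)) = 1"
    using inverse_linear_fps_mult[of b] inverse_linear_fps_mult[of "b + 1"] 1
    by (simp_all add: J_def K_def X_def B_def[symmetric] B1)
  have "moment_fps b (shifted_legendre (Suc 0)) = 2 * K - J"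
    by (simp add: shifted_legendre_1 moment_fps_def J_def K_def algebra_simps
        numeral_fps_const flip: fps_const_neg)
  moreover have "(2 * K - J) * ((X + B) * (X + (B + 1))) = X + (B - 1)"
    using J K by algebra
  moreover have "(\<Prod>j\<le>Suc 0. fps_X + fps_const (b + real j)) = (X + B) * (X + (B + 1))"
    "(\<Prod>j<Suc 0. fps_X + fps_const (b - 1 - real j)) = X + (B - 1)"
    by (simp_all add: B1 X_def B_def)
  ultimately show ?case
    by (simp only: One_nat_def)
next
  case (ge2 n)
  define X where "X = (fps_X :: real fps)"
  define B where "B = fps_const b"
  define m where "m = fps_const (real n)"
  define N where "N = (\<Prod>j<n. X + fps_const (b - 1 - real j))"
  define E where "E = (\<Prod>j\<le>n. X + fps_const (b + real j))"
  define g0 where "g0 = moment_fps b (shifted_legendre n)"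
  define g1 where "g1 = moment_fps b (shifted_legendre (Suc n))"
  define g1' where "g1' = moment_fps (b + 1) (shifted_legendre (Suc n))"
  define g2 where "g2 = moment_fps b (shifted_legendre (Suc (Suc n)))"
  have c1: "fps_const (b + real (Suc n)) = B + m + 1"
    "fps_const (b + real (Suc (Suc n))) = B + m + 2"
    "fps_const (b - 1 - real n) = B - 1 - m"
    "fps_const (b - 1 - real (Suc n)) = B - 2 - m"
    "fps_const (real n + 2) = m + 2" "fps_const (2 * real n + 3) = 2 * m + 3" "fps_const (real n + 1) = m + 1"
    by (simp_all add: B_def m_def numeral_fps_const fps_const_sub[symmetric] fps_const_add[symmetric]
       flip: fps_const_mult del: fps_const_add fps_const_sub)
  have 0: "g0 * E = N"
    using ge2.IH(1)[OF ge2.prems] by (simp only: g0_def E_def N_def X_def)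
  have 1: "g1 * (E * (X + (B + m + 1))) = N * (X + (B - 1 - m))"
    using ge2.IH(2)[OF ge2.prems]
    by (simp only: g1_def E_def N_def X_def prod.atMost_Suc prod.lessThan_Suc c1)
  \<comment> \<open>Passing from \<open>b\<close> to \<open>b + 1\<close> drops the first
    denominator factor and appends one at the end; multiplying by \<open>X + B\<close> restores a
    denominator common to all three terms.\<close>
  have E': "(X + B) * (\<Prod>j\<le>Suc n. X + fps_const (b + 1 + real j)) = E * (X + (B + m + 1)) * (X + (B + m + 2))"
  proof -
    have "(\<Prod>j\<le>Suc (Suc n). X + fps_const (b + real j)) = (X + B) * (\<Prod>j\<le>Suc n. X + fps_const (b + 1 + real j))"
      by (subst prod.atMost_Suc_shift) (simp add: B_def algebra_simps del: prod.atMost_Suc)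
    then show ?thesis
      by (simp only: prod.atMost_Suc E_def c1)
  qed
  have N': "(\<Prod>j<Suc n. X + fps_const (b + 1 - 1 - real j)) = (X + B) * N"
    by (subst prod.lessThan_Suc_shift) (simp add: B_def N_def algebra_simps)
  have "g1' * (\<Prod>j\<le>Suc n. X + fps_const (b + 1 + real j)) = (X + B) * N"
    using ge2.IH(2)[of "b + 1"] ge2.prems N' by (simp only: g1'_def X_def)
  then have gs: "g1' * (E * (X + (B + m + 1)) * (X + (B + m + 2))) = (X + B) * (X + B) * N"
    unfolding E'[symmetric] by (simp add: mult_ac)
  have step: "(m + 2) * g2 = (2 * m + 3) * (2 * g1' - g1) - (m + 1) * g0"
    using moment_shifted_legendre_recurrence[of n b]
    by (simp only: g0_def g1_def g1'_def g2_def c1)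
  have "(m + 2) * (g2 * (E * (X + (B + m + 1)) * (X + (B + m + 2)))) = (m + 2) * (N * (X + (B - 1 - m)) * (X + (B - 2 - m)))"
  proof -
    have "(m + 2) * (g2 * (E * (X + (B + m + 1)) * (X + (B + m + 2))))
        = ((m + 2) * g2) * (E * (X + (B + m + 1)) * (X + (B + m + 2)))"
      by (simp only: mult.assoc)
    also have "\<dots> = (2 * m + 3) * (2 * (g1' * (E * (X + (B + m + 1)) * (X + (B + m + 2))))
        - (g1 * (E * (X + (B + m + 1)))) * (X + (B + m + 2)))
        - (m + 1) * ((g0 * E) * ((X + (B + m + 1)) * (X + (B + m + 2))))"
      unfolding step by (simp only: left_diff_distrib right_diff_distrib mult_ac)
    also have "\<dots> = (m + 2) * (N * (X + (B - 1 - m)) * (X + (B - 2 - m)))"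
      unfolding 0 1 gs by (simp add: algebra_simps)
    finally show ?thesis .
  qed
  moreover have "m + 2 \<noteq> 0"
    unfolding c1(5)[symmetric] by simp
  ultimately have "g2 * (E * (X + (B + m + 1)) * (X + (B + m + 2))) = N * (X + (B - 1 - m)) * (X + (B - 2 - m))"
    by simp
  then show ?case
    by (simp only: g2_def E_def N_def X_def prod.atMost_Suc prod.lessThan_Suc c1)
qed

text \<open>At b = 1/2, up to sign, the numerator is \<open>t_fps n\<close> and the inverse
  denominator \<open>t_star_fps (Suc n)\<close>, both up to products of half-integers. The
  denominator has one factor more, hence the index n + 1; the surplus half-integer n + 1/2 is half
  of the normalisation 2n + 1.\<close>

lemma moment_half_shifted_legendre:
  "fps_const (2 * real n + 1) * moment_fps (1/2) (shifted_legendre n) =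
     2 * (-1) ^ n * t_fps n * t_star_fps (Suc n)"
proof -
  define r where "r = (\<Prod>j<n. real j + 1/2)"
  have r: "r \<noteq> 0" unfolding r_def by (subst prod_zero_iff) (auto simp: add_nonneg_eq_0_iff)
  define G where "G = moment_fps (1/2) (shifted_legendre n)"
  define Q where "Q = (\<Prod>j<Suc n. fps_X + fps_const (1/2 + real j))"
  have "G * Q = (\<Prod>j<n. fps_X + fps_const (1/2 - 1 - real j))"
    unfolding G_def Q_def using moment_shifted_legendre[of "1/2" n]
    by (simp add: lessThan_Suc_atMost del: prod.lessThan_Suc)
  also have "\<dots> = (\<Prod>j<n. fps_X - fps_const (1/2 + real j))"
    by (intro prod.cong refl) (simp add: fps_eq_iff)
  finally have GQ: "G * Q = (-1) ^ n * (t_fps n * fps_const r)"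
    unfolding r_def t_fps_prod by (simp add: mult.assoc[symmetric] flip: power_mult_distrib)
  have TQ: "t_star_fps (Suc n) * Q = fps_const (r * (real n + 1/2))"
    unfolding Q_def t_star_fps_prod r_def by simp
  have "G * fps_const (r * (real n + 1/2)) = t_star_fps (Suc n) * (G * Q)"
    unfolding TQ[symmetric] by (simp add: mult_ac)
  then have "fps_const r * (fps_const (real n + 1/2) * G) = fps_const r * ((-1) ^ n * t_fps n * t_star_fps (Suc n))"
    unfolding GQ by (simp add: mult_ac flip: fps_const_mult)
  then have "fps_const (real n + 1/2) * G = (-1) ^ n * t_fps n * t_star_fps (Suc n)"
    using r by simp
  then have "fps_const 2 * (fps_const (real n + 1/2) * G) = fps_const 2 * ((-1) ^ n * t_fps n * t_star_fps (Suc n))"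
    by simp
  then show ?thesis
    unfolding G_def mult.assoc[symmetric] by (simp add: numeral_fps_const algebra_simps)
qed

lemma coeff_half_shifted_legendre:
  "(2 * real n + 1) * (moment_fps (1/2) (shifted_legendre n) $ m) =
     (-1) ^ m * 2 ^ (m + 1) *
     (\<Sum>k=0..m. (-1) ^ n * t_sum n (replicate k 1) * t_star_sum (n + 1) (replicate (m - k) 1))"
proof -
  have "(2 * real n + 1) * (moment_fps (1/2) (shifted_legendre n) $ m) =
      (fps_const (2 * (-1) ^ n) * (t_fps n * t_star_fps (Suc n))) $ m"
    using arg_cong[OF moment_half_shifted_legendre[of n], of "\<lambda>f. fps_nth f m"]
    by (simp add: numeral_fps_const mult.assoc flip: fps_const_mult fps_const_power fps_const_neg)
  also have "\<dots> = 2 * (-1) ^ n * (\<Sum>k=0..m. (-2) ^ m * (t_sum n (replicate k 1) * t_star_sum (n + 1) (replicate (m - k) 1)))"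
    unfolding fps_mult_left_const_nth unfolding fps_mult_nth
  proof (rule arg_cong[OF sum.cong[OF refl], of _ _ _ "\<lambda>s. 2 * (-1) ^ n * s"])
    fix k assume "k \<in> {0..m}"
    then have "(-2 :: real) ^ m = (-2) ^ k * (-2) ^ (m - k)"
      by (simp flip: power_add)
    then show "t_fps n $ k * t_star_fps (Suc n) $ (m - k) =
        (-2) ^ m * (t_sum n (replicate k 1) * t_star_sum (n + 1) (replicate (m - k) 1))"
      by (simp add: t_fps_def t_star_fps_def)
  qed
  also have "\<dots> = (-1) ^ m * 2 ^ (m + 1) *
     (\<Sum>k=0..m. (-1) ^ n * t_sum n (replicate k 1) * t_star_sum (n + 1) (replicate (m - k) 1))"
    by (simp add: sum_distrib_left power_minus[of 2] mult_ac)
  finally show ?thesis .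
qed

section \<open>Orthogonality and the expansion of powers\<close>

text \<open>Orthogonality to lower powers: coefficient 0 at d + 1 is the integral of
  \<open>x ^ d\<close> against the polynomial, and the numerator contains the vanishing factor j =
  d.\<close>

lemma moment_shifted_legendre_eq_0:
  assumes "d < n"
  shows "moment_fps (real d + 1) (shifted_legendre n) $ 0 = 0"
proof -
  have *: "(\<Prod>j\<in>A. fps_X + fps_const (f j)) $ 0 = (\<Prod>j\<in>A. f j)" for A and f :: "nat \<Rightarrow> real"
    by (induction A rule: infinite_finite_induct) auto
  have "(moment_fps (real d + 1) (shifted_legendre n) $ 0) * (\<Prod>j\<le>n. real d + 1 + real j) = (\<Prod>j<n. real d - real j)"
    using arg_cong[OF moment_shifted_legendre[of "real d + 1" n], of "\<lambda>f. fps_nth f 0"] by (simp add: *)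
  also have "\<dots> = 0" using assms by auto
  finally show ?thesis by (auto simp: add_nonneg_eq_0_iff)
qed

text \<open>The Legendre expansion of a power, proved by induction on \<open>d\<close>. Multiplying
  the expansion of \<open>x ^ d\<close> by x must give that of \<open>x ^ Suc d\<close>; the
  difference of the two partial sums is evaluated in closed form.\<close>

lemma power_shifted_legendre_expansion:
  assumes "d < N"
  shows "x ^ d = (\<Sum>n\<le>N. (2 * real n + 1) * (moment_fps (real d + 1) (shifted_legendre n) $ 0) *
           poly (shifted_legendre n) x)"
  using assms
proof (induction d arbitrary: N)
  case 0
  have "(\<Sum>n\<le>N. (2 * real n + 1) * (moment_fps (real 0 + 1) (shifted_legendre n) $ 0) * poly (shifted_legendre n) x)
     = (\<Sum>n\<in>{0}. (2 * real n + 1) * (moment_fps (real 0 + 1) (shifted_legendre n) $ 0) * poly (shifted_legendre n) x)"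
    by (rule sum.mono_neutral_right) (use moment_shifted_legendre_eq_0[of 0] in auto)
  then show ?case
    by (simp add: shifted_legendre_0 moment_fps_def inverse_linear_fps_def)
next
  case (Suc d)
  define I where "I = (\<lambda>n. moment_fps (real d + 1) (shifted_legendre n) $ 0)"
  define I' where "I' = (\<lambda>n. moment_fps (real d + 2) (shifted_legendre n) $ 0)"
  define S where "S = (\<lambda>n. poly (shifted_legendre n) x)"
  have rI: "(real n + 2) * I (Suc (Suc n)) = (2 * real n + 3) * (2 * I' (Suc n) - I (Suc n)) - (real n + 1) * I n" for n
    using arg_cong[OF moment_shifted_legendre_recurrence[of n "real d + 1"], of "\<lambda>f. fps_nth f 0"]
    by (simp add: I_def I'_def numeral_fps_const algebra_simps)
  have rS: "(real n + 2) * S (Suc (Suc n)) = (2 * real n + 3) * (2 * x * S (Suc n) - S (Suc n)) - (real n + 1) * S n" for n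
    using arg_cong[OF shifted_legendre_recurrence[of n], of "\<lambda>p. poly p x"]
    by (simp add: S_def algebra_simps)
  have S01: "S 0 = 1" "S (Suc 0) = 2 * x - 1"
    by (simp_all add: S_def shifted_legendre_0 shifted_legendre_1)
  have I1: "I (Suc 0) = 2 * I' 0 - I 0"
    by (simp add: I_def I'_def shifted_legendre_0 shifted_legendre_1 moment_fps_def inverse_linear_fps_def add_ac)
  \<comment> \<open>As in the Christoffel--Darboux formula, the two three-term recurrences make the sum telescope.\<close>
  have CD: "(\<Sum>n\<le>M. (2 * real n + 1) * (I n * x * S n - I' n * S n)) = (real M + 1) / 2 * (I M * S (Suc M) - I (Suc M) * S M)" for M
  proof (induction M)
    case 0
    show ?case by (simp add: S01 I1 algebra_simps)
  next
    case (Suc M)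
    have "2 * ((real M + 1) / 2 * (I M * S (Suc M) - I (Suc M) * S M) + (2 * real (Suc M) + 1) * (I (Suc M) * x * S (Suc M) - I' (Suc M) * S (Suc M)))
       = I (Suc M) * ((2 * real M + 3) * (2 * x * S (Suc M) - S (Suc M)) - (real M + 1) * S M)
       - ((2 * real M + 3) * (2 * I' (Suc M) - I (Suc M)) - (real M + 1) * I M) * S (Suc M)"
      by (simp add: field_simps)
    also have "\<dots> = I (Suc M) * ((real M + 2) * S (Suc (Suc M))) - ((real M + 2) * I (Suc (Suc M))) * S (Suc M)"
      unfolding rI rS ..
    also have "\<dots> = 2 * ((real (Suc M) + 1) / 2 * (I (Suc M) * S (Suc (Suc M)) - I (Suc (Suc M)) * S (Suc M)))"
      by (simp add: field_simps)
    finally have "(real M + 1) / 2 * (I M * S (Suc M) - I (Suc M) * S M) +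
        (2 * real (Suc M) + 1) * (I (Suc M) * x * S (Suc M) - I' (Suc M) * S (Suc M)) =
        (real (Suc M) + 1) / 2 * (I (Suc M) * S (Suc (Suc M)) - I (Suc (Suc M)) * S (Suc M))"
      by (rule mult_left_cancel[THEN iffD1, rotated]) simp
    then show ?case by (simp only: sum.atMost_Suc Suc.IH)
  qed
  \<comment> \<open>Orthogonality to lower powers makes the closed form vanish.\<close>
  have "I N = 0" "I (Suc N) = 0"
    using Suc.prems by (auto simp: I_def moment_shifted_legendre_eq_0)
  then have "(\<Sum>n\<le>N. (2 * real n + 1) * (I n * x * S n - I' n * S n)) = 0"
    by (subst CD) simp
  then have "(\<Sum>n\<le>N. (2 * real n + 1) * I' n * S n) = x * (\<Sum>n\<le>N. (2 * real n + 1) * I n * S n)"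
    by (simp add: right_diff_distrib sum_subtractf sum_distrib_left mult_ac)
  also have "\<dots> = x * x ^ d"
    using Suc.IH[of N] Suc.prems by (simp add: I_def S_def)
  finally show ?case by (simp add: I'_def S_def add_ac)
qed

section \<open>Integrals and moments\<close>

text \<open>With t = - b ln x this is, up to a constant, t^m / exp t as t tends to infinity.\<close>

lemma powr_mult_ln_power_tendsto_0:
  fixes b :: real
  assumes "(b::real) > 0"
  shows "((\<lambda>x. x powr b * (- ln x) ^ m) \<longlongrightarrow> 0) (at_right 0)"
proof -
  have "filterlim (\<lambda>x::real. - ln x) at_top (at_right 0)"
    using ln_at_0 by (simp add: filterlim_uminus_at_bot)
  then have "filterlim (\<lambda>x. b * (- ln x)) at_top (at_right 0)"
    by (rule filterlim_tendsto_pos_mult_at_top[OF tendsto_const assms])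
  then have "((\<lambda>x. (b * (- ln x)) ^ m / exp (b * (- ln x))) \<longlongrightarrow> 0) (at_right 0)"
    by (rule filterlim_compose[OF tendsto_power_div_exp_0])
  then have "((\<lambda>x. (1 / b ^ m) * ((b * (- ln x)) ^ m / exp (b * (- ln x)))) \<longlongrightarrow> (1 / b ^ m) * 0) (at_right 0)"
    by (rule tendsto_mult_left)
  moreover have "\<forall>\<^sub>F x in at_right 0. (1 / b ^ m) * ((b * (- ln x)) ^ m / exp (b * (- ln x))) = x powr b * (- ln x) ^ m"
    using eventually_at_right_less[of 0]
  proof eventually_elim
    case (elim x)
    have "x powr b = 1 / exp (b * (- ln x))"
      using elim by (simp add: powr_def exp_minus field_simps)
    then show ?case
      using assms by (simp only: power_mult_distrib) simp
  qed
  ultimately show ?thesis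
    by (simp add: tendsto_cong)
qed

text \<open>The antiderivative of x^(b-1) (-ln x)^m obtained by repeated integration by parts. Using
  - ln x keeps the integrand non-negative on (0, 1).\<close>

primrec powr_ln_antideriv :: "real \<Rightarrow> nat \<Rightarrow> real \<Rightarrow> real" where
  "powr_ln_antideriv b 0 = (\<lambda>x. x powr b / b)"
| "powr_ln_antideriv b (Suc m) =
     (\<lambda>x. (x powr b * (- ln x) ^ Suc m + real (Suc m) * powr_ln_antideriv b m x) / b)"

lemma powr_ln_antideriv_deriv:
  assumes "(b::real) > 0" "x > 0"
  shows "(powr_ln_antideriv b m has_real_derivative x powr (b - 1) * (- ln x) ^ m) (at x)"
proof (induction m)
  case 0
  have "((\<lambda>x. x powr b / b) has_real_derivative (b * x powr (b - 1)) / b) (at x)"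
    using assms by (intro DERIV_cdivide has_real_derivative_powr)
  then show ?case using assms by simp
next
  case (Suc m)
  have powr: "((\<lambda>x. x powr b) has_real_derivative b * x powr (b - 1)) (at x)"
    using assms by (intro has_real_derivative_powr)
  have "(ln has_real_derivative inverse x) (at x)"
    using assms by (intro DERIV_ln)
  from DERIV_power[OF DERIV_minus[OF this], of "Suc m"]
  have log_pow: "((\<lambda>x. (- ln x) ^ Suc m) has_real_derivative real (Suc m) * (- ln x) ^ m * (- inverse x)) (at x)"
    by (simp add: mult_ac del: power_Suc)
  have "((\<lambda>x. (x powr b * (- ln x) ^ Suc m + real (Suc m) * powr_ln_antideriv b m x) / b) has_real_derivative
     ((b * x powr (b - 1)) * (- ln x) ^ Suc m + x powr b * (real (Suc m) * (- ln x) ^ m * (- inverse x))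
       + real (Suc m) * (x powr (b - 1) * (- ln x) ^ m)) / b) (at x)"
    by (rule DERIV_cdivide[OF DERIV_add[OF DERIV_mult[OF powr log_pow] DERIV_cmult[OF Suc.IH]], THEN DERIV_cong])
       (simp add: algebra_simps)
  also have "x powr b * (real (Suc m) * (- ln x) ^ m * (- inverse x)) = - (real (Suc m) * (x powr (b - 1) * (- ln x) ^ m))"
    using assms by (simp add: powr_diff field_simps)
  also have "((b * x powr (b - 1)) * (- ln x) ^ Suc m + - (real (Suc m) * (x powr (b - 1) * (- ln x) ^ m))
       + real (Suc m) * (x powr (b - 1) * (- ln x) ^ m)) / b = x powr (b - 1) * (- ln x) ^ Suc m"
    using assms by simp
  finally show ?case by simp
qed

lemma powr_ln_antideriv_tendsto_0:
  assumes "(b::real) > 0"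
  shows "(powr_ln_antideriv b m \<longlongrightarrow> 0) (at_right 0)"
proof (induction m)
  case 0
  show ?case
    using tendsto_divide_zero[OF powr_mult_ln_power_tendsto_0[OF assms, of 0]] by simp
next
  case (Suc m)
  have "((\<lambda>x. (x powr b * (- ln x) ^ Suc m + real (Suc m) * powr_ln_antideriv b m x) / b) \<longlongrightarrow>
      (0 + real (Suc m) * 0) / b) (at_right 0)"
    by (intro tendsto_intros powr_mult_ln_power_tendsto_0 Suc.IH assms) (use assms in auto)
  then show ?case by simp
qed

lemma powr_ln_antideriv_1:
  fixes b :: real
  shows "b > 0 \<Longrightarrow> powr_ln_antideriv b m 1 = fact m / b ^ Suc m"
  by (induction m) (simp_all add: field_simps)

lemma has_bochner_integral_powr_ln:
  assumes "(b::real) > 0"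
  shows "has_bochner_integral lborel (\<lambda>x. indicator {0<..<1} x *\<^sub>R (x powr (b - 1) * ln x ^ m))
           ((-1) ^ m * fact m / b ^ Suc m)"
proof -
  have 1: "((powr_ln_antideriv b m \<circ> real_of_ereal) \<longlongrightarrow> 0) (at_right (ereal 0))"
    unfolding ereal_tendsto_simps1 by (rule powr_ln_antideriv_tendsto_0[OF assms])
  have "isCont (powr_ln_antideriv b m) 1"
    by (rule DERIV_isCont, rule powr_ln_antideriv_deriv) (use assms in auto)
  then have 2: "((powr_ln_antideriv b m \<circ> real_of_ereal) \<longlongrightarrow> fact m / b ^ Suc m) (at_left (ereal 1))"
    unfolding ereal_tendsto_simps1 powr_ln_antideriv_1[OF assms, symmetric] isCont_def
    by (rule tendsto_within_subset[OF _ subset_UNIV])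
  have cont: "isCont (\<lambda>x. x powr (b - 1) * (- ln x) ^ m) x" if "x > 0" for x
    using that by (intro continuous_intros) auto
  have nonneg: "AE x in lborel. ereal 0 < ereal x \<longrightarrow> ereal x < ereal 1 \<longrightarrow> 0 \<le> x powr (b - 1) * (- ln x) ^ m"
    by (auto intro!: AE_I2 mult_nonneg_nonneg zero_le_power)
  \<comment> \<open>For a non-negative integrand, the one-sided limits of an antiderivative at the
    end points give both integrability and the value of the integral.\<close>
  note FTC = interval_integral_FTC_nonneg[of "ereal 0" "ereal 1" "powr_ln_antideriv b m",
      OF _ _ _ nonneg 1 2]
  have "set_integrable lborel (einterval (ereal 0) (ereal 1)) (\<lambda>x. x powr (b - 1) * (- ln x) ^ m)"
    by (rule FTC) (use powr_ln_antideriv_deriv[OF assms] cont in auto)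
  moreover have "(LBINT x=ereal 0..ereal 1. x powr (b - 1) * (- ln x) ^ m) = fact m / b ^ Suc m - 0"
    by (rule FTC) (use powr_ln_antideriv_deriv[OF assms] cont in auto)
  ultimately have "has_bochner_integral lborel
      (\<lambda>x. indicator {0<..<1} x *\<^sub>R (x powr (b - 1) * (- ln x) ^ m)) (fact m / b ^ Suc m)"
    by (simp add: has_bochner_integral_iff set_integrable_def interval_lebesgue_integral_le_eq
        set_lebesgue_integral_def)
  then have scaled: "has_bochner_integral lborel
      (\<lambda>x. (-1) ^ m * (indicator {0<..<1} x *\<^sub>R (x powr (b - 1) * (- ln x) ^ m))) ((-1) ^ m * (fact m / b ^ Suc m))"
    by (intro has_bochner_integral_mult_right)
  have "(-1) ^ m * (- ln x) ^ m = ln x ^ m" for x :: real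
    by (simp flip: power_mult_distrib)
  then have eq: "(-1) ^ m * (indicator {0<..<1} x *\<^sub>R (x powr (b - 1) * (- ln x) ^ m)) =
      indicator {0<..<1} x *\<^sub>R (x powr (b - 1) * ln x ^ m)" for x :: real
    by (simp add: mult.left_commute[of "(-1) ^ m"])
  show ?thesis
    using scaled unfolding eq times_divide_eq_right .
qed

lemma has_bochner_integral_ln_power_div_sqrt_poly:
  "has_bochner_integral lborel (\<lambda>x. indicator {0<..<1} x *\<^sub>R (ln x ^ m / sqrt x * poly p x))
     (fact m * (moment_fps (1/2) p $ m))"
proof -
  have 1: "has_bochner_integral lborel
      (\<lambda>x. \<Sum>i\<le>degree p. coeff p i * (indicator {0<..<1} x *\<^sub>R (x powr (1/2 + real i - 1) * ln x ^ m)))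
      (\<Sum>i\<le>degree p. coeff p i * ((-1) ^ m * fact m / (1/2 + real i) ^ Suc m))"
    by (rule has_bochner_integral_sum, rule has_bochner_integral_mult_right, rule has_bochner_integral_powr_ln) simp
  have 2: "(\<lambda>x. \<Sum>i\<le>degree p. coeff p i * (indicator {0<..<1} x *\<^sub>R (x powr (1/2 + real i - 1) * ln x ^ m)))
      = (\<lambda>x. indicator {0<..<1} x *\<^sub>R (ln x ^ m / sqrt x * poly p x))"
  proof
    fix x :: real
    show "(\<Sum>i\<le>degree p. coeff p i * (indicator {0<..<1} x *\<^sub>R (x powr (1/2 + real i - 1) * ln x ^ m)))
        = indicator {0<..<1} x *\<^sub>R (ln x ^ m / sqrt x * poly p x)"
    proof (cases "x \<in> {0<..<1}")
      case True
      have "x powr (1/2 + real i - 1) = x ^ i / sqrt x" for i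
      proof -
        have "x powr (1/2 + real i - 1) = x powr (real i - 1/2)" by (simp add: algebra_simps)
        also have "\<dots> = x ^ i / sqrt x"
          using True by (simp only: powr_diff powr_realpow powr_half_sqrt greaterThanLessThan_iff less_imp_le)
        finally show ?thesis .
      qed
      then show ?thesis
        using True by (auto simp: poly_altdef sum_distrib_left intro!: sum.cong)
    qed simp
  qed
  have 3: "(\<Sum>i\<le>degree p. coeff p i * ((-1) ^ m * fact m / (1/2 + real i) ^ Suc m))
      = fact m * (moment_fps (1/2) p $ m)"
    unfolding moment_fps_def fps_sum_nth sum_distrib_left
    by (rule sum.cong) (simp_all add: inverse_linear_fps_def)
  show ?thesis
    using 1 unfolding 2 3 .
qed

lemma has_integral_poly_01: "(poly p has_integral (moment_fps 1 p $ 0)) {0..1}"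
proof -
  have "((\<lambda>x. x ^ i) has_integral (1 / (1 + real i))) {0..1}" for i
  proof -
    have "((\<lambda>x. x ^ Suc i / real (Suc i)) has_vector_derivative x ^ i) (at x within {0..1})" for x :: real
      unfolding has_real_derivative_iff_has_vector_derivative[symmetric]
      by (rule DERIV_cdivide[THEN DERIV_cong, OF DERIV_power[OF DERIV_ident]]) simp
    then have "((\<lambda>x. x ^ i) has_integral (1 ^ Suc i / real (Suc i) - 0 ^ Suc i / real (Suc i))) {0..1}"
      by (intro fundamental_theorem_of_calculus) auto
    then show ?thesis by (simp add: add_ac)
  qed
  then have "((\<lambda>x. \<Sum>i\<le>degree p. coeff p i * x ^ i) has_integral (\<Sum>i\<le>degree p. coeff p i * (1 / (1 + real i)))) {0..1}"
    by (intro has_integral_sum has_integral_mult_right) auto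
  then show ?thesis
    by (simp add: moment_fps_def inverse_linear_fps_def fps_sum_nth poly_altdef[abs_def])
qed

section \<open>Uniqueness from moments\<close>

text \<open>The function is orthogonal to every polynomial p, so the integral of g^2 equals that of
  g (g - p), which is arbitrarily small for a Weierstrass approximation p. Continuity then forces
  g^2 = 0 everywhere.\<close>

lemma continuous_on_vanishing_moments:
  fixes g :: "real \<Rightarrow> real"
  assumes cont: "continuous_on {0..1} g"
    and moments: "\<And>d. integral {0..1} (\<lambda>x. x ^ d * g x) = 0"
    and x: "x \<in> {0..1}"
  shows "g x = 0"
proof -
  have "bounded (g ` {0..1})"
    by (rule compact_imp_bounded[OF compact_continuous_image[OF cont compact_Icc]])
  then obtain B where B: "\<And>x. x \<in> {0..1} \<Longrightarrow> \<bar>g x\<bar> \<le> B"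
    unfolding bounded_iff real_norm_def by blast
  have B0: "B \<ge> 0" using B[of 0] by simp
  have int: "(\<lambda>x. h x) integrable_on {0..1}" if "continuous_on {0..1} h" for h :: "real \<Rightarrow> real"
    using that by (rule integrable_continuous_interval)
  have le: "\<bar>integral {0..1} (\<lambda>x. g x * g x)\<bar> \<le> B * e" if "e > 0" for e
  proof -
    obtain p where p: "real_polynomial_function p" "\<And>x. x \<in> {0..1} \<Longrightarrow> \<bar>g x - p x\<bar> < e"
      using Stone_Weierstrass_real_polynomial_function[OF compact_Icc cont \<open>e > 0\<close>] by blast
    obtain a n where a: "p = (\<lambda>x. \<Sum>i\<le>n. a i * x ^ i)"
      using p(1) real_polynomial_function_iff_sum by blast
    have cp: "continuous_on {0..1} p" unfolding a by (intro continuous_intros)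
    have "integral {0..1} (\<lambda>x. g x * p x) = integral {0..1} (\<lambda>x. \<Sum>i\<le>n. a i * (x ^ i * g x))"
      by (simp add: a sum_distrib_left mult_ac)
    also have "\<dots> = (\<Sum>i\<le>n. integral {0..1} (\<lambda>x. a i * (x ^ i * g x)))"
      by (rule integral_sum) (auto intro!: int continuous_intros cont)
    also have "\<dots> = 0" by (simp add: moments)
    finally have "integral {0..1} (\<lambda>x. g x * g x) = integral {0..1} (\<lambda>x. g x * g x) - integral {0..1} (\<lambda>x. g x * p x)"
      by simp
    also have "\<dots> = integral {0..1} (\<lambda>x. g x * g x - g x * p x)"
      by (rule integral_diff[symmetric]; intro int continuous_intros cont cp)
    also have "\<bar>\<dots>\<bar> \<le> (B * e) * (1 - 0)"
      unfolding real_norm_def[symmetric]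
    proof (rule integral_bound)
      fix t :: real assume t: "t \<in> {0..1}"
      have "\<bar>g t\<bar> * \<bar>g t - p t\<bar> \<le> B * e"
        using B[OF t] p(2)[OF t] B0 by (intro mult_mono) auto
      then show "norm (g t * g t - g t * p t) \<le> B * e"
        by (simp add: abs_mult flip: right_diff_distrib)
    qed (auto intro!: continuous_intros cont cp)
    finally show ?thesis by simp
  qed
  have "\<bar>integral {0..1} (\<lambda>x. g x * g x)\<bar> \<le> 0"
  proof (rule field_le_epsilon)
    fix e :: real assume "e > 0"
    \<comment> \<open>Dividing by \<open>B + 1\<close> covers the case B = 0.\<close>
    have "B * (e / (B + 1)) \<le> e" using B0 \<open>e > 0\<close> by (simp add: field_simps)
    with le[of "e / (B + 1)"] B0 \<open>e > 0\<close> show "\<bar>integral {0..1} (\<lambda>x. g x * g x)\<bar> \<le> 0 + e" by simp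
  qed
  then have "integral {0..1} (\<lambda>x. g x * g x) = 0" by simp
  then have "\<forall>x\<in>{0..1}. g x * g x = 0"
    by (subst (asm) integral_eq_0_iff) (auto intro!: continuous_intros cont)
  then show ?thesis using x by auto
qed

section \<open>Growth of the coefficients\<close>

text \<open>The added 1 keeps the value at least 1, so that its powers increase with the
  exponent.\<close>

definition odd_harmonic :: "nat \<Rightarrow> real" where
  "odd_harmonic n = 1 + (\<Sum>j<n. 1 / (2 * real j + 1))"

lemma odd_harmonic_Suc: "odd_harmonic (Suc n) = odd_harmonic n + 1 / (2 * real n + 1)"
  by (simp add: odd_harmonic_def)

lemma odd_harmonic_ge_1: "odd_harmonic n \<ge> 1"
  by (simp add: odd_harmonic_def sum_nonneg)

lemma odd_harmonic_mono: "m \<le> n \<Longrightarrow> odd_harmonic m \<le> odd_harmonic n"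
  unfolding odd_harmonic_def by (auto intro!: sum_mono2)

lemma odd_harmonic_le_ln: "odd_harmonic n \<le> 1 + 2 * ln (real n + 1)"
proof (induction n)
  case (Suc n)
  have "ln ((real n + 1) / (real n + 2)) \<le> (real n + 1) / (real n + 2) - 1"
    by (rule ln_le_minus_one) simp
  also have "\<dots> = - (1 / (real n + 2))" by (simp add: field_simps)
  finally have "1 / (real n + 2) \<le> ln (real n + 2) - ln (real n + 1)"
    by (simp add: ln_div)
  then have "2 * (1 / (real n + 2)) \<le> 2 * (ln (real n + 2) - ln (real n + 1))"
    by (rule mult_left_mono) simp
  moreover have "1 / (2 * real n + 1) \<le> 2 * (1 / (real n + 2))"
    by (simp add: field_simps)
  ultimately have "1 / (2 * real n + 1) \<le> 2 * (ln (real n + 2) - ln (real n + 1))"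
    by (rule order_trans[rotated])
  with Suc.IH show ?case by (simp add: odd_harmonic_Suc add_ac)
qed (simp add: odd_harmonic_def)

text \<open>Powers of a logarithm are absorbed into a small power of n. The exponent 1/4 is below
  1/2, which is what the weights of order sqrt n below can afford.\<close>

lemma odd_harmonic_power_bound:
  obtains C where "C > 0" "\<And>n. odd_harmonic (n + 2) ^ m \<le> C * (real n + 3) powr (1/4)"
proof -
  \<comment> \<open>Chosen so that the m-th power costs at most the exponent 1/4;
    \<open>Suc m\<close> avoids division by zero for m = 0.\<close>
  define \<delta> where "\<delta> = 1 / (4 * real (Suc m))"
  have \<delta>: "\<delta> > 0" by (simp add: \<delta>_def)
  show ?thesis
  proof
    show "(1 + 2 / \<delta>) ^ m > 0" using \<delta> by (intro zero_less_power add_pos_pos) auto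
    fix n :: nat
    have "odd_harmonic (n + 2) \<le> 1 + 2 * ln (real n + 3)"
      using odd_harmonic_le_ln[of "n + 2"] by (simp add: add_ac)
    also have "\<dots> \<le> 1 + 2 * ((real n + 3) powr \<delta> / \<delta>)"
      using ln_powr_bound[of "real n + 3" \<delta>] \<delta> by simp
    also have "\<dots> \<le> (real n + 3) powr \<delta> + 2 * ((real n + 3) powr \<delta> / \<delta>)"
      using \<delta> by (simp add: ge_one_powr_ge_zero)
    also have "\<dots> = (1 + 2 / \<delta>) * (real n + 3) powr \<delta>"
      by (simp add: field_simps)
    finally have "odd_harmonic (n + 2) ^ m \<le> ((1 + 2 / \<delta>) * (real n + 3) powr \<delta>) ^ m"
      using odd_harmonic_ge_1[of "n + 2"] by (intro power_mono) auto
    also have "\<dots> = (1 + 2 / \<delta>) ^ m * (real n + 3) powr (\<delta> * real m)"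
      by (simp add: power_mult_distrib powr_power mult_ac)
    also have "\<dots> \<le> (1 + 2 / \<delta>) ^ m * (real n + 3) powr (1/4)"
    proof (intro mult_left_mono powr_mono)
      show "\<delta> * real m \<le> 1/4" by (simp add: \<delta>_def field_simps)
    qed (use \<delta> in auto)
    finally show "odd_harmonic (n + 2) ^ m \<le> (1 + 2 / \<delta>) ^ m * (real n + 3) powr (1/4)" .
  qed
qed

text \<open>With h = \<open>odd_harmonic n\<close> and l + 1 ones, the recursion gives the bound
  h^(l+1) + h^l / (2n + 1), which is h^l times \<open>odd_harmonic (Suc n)\<close>.\<close>

lemma t_sum_ones_bounds: "0 \<le> t_sum n (replicate k 1) \<and> t_sum n (replicate k 1) \<le> odd_harmonic n ^ k"
proof (induction n arbitrary: k)
  case 0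
  show ?case by (cases k) (simp_all add: t_sum_0_ones odd_harmonic_def del: replicate_Suc One_nat_def)
next
  case (Suc n)
  show ?case
  proof (cases k)
    case (Suc l)
    have "t_sum (Suc n) (replicate k 1) = t_sum n (replicate (Suc l) 1) + t_sum n (replicate l 1) / (2 * real n + 1)"
      unfolding Suc by (rule t_sum_Suc_ones)
    moreover have "\<dots> \<le> odd_harmonic n ^ Suc l + odd_harmonic n ^ l / (2 * real n + 1)"
      using Suc.IH[of "Suc l"] Suc.IH[of l]
      by (intro add_mono divide_right_mono) (simp_all del: replicate_Suc power_Suc One_nat_def)
    moreover have "\<dots> = odd_harmonic n ^ l * odd_harmonic (Suc n)"
      by (simp add: odd_harmonic_Suc algebra_simps)
    moreover have "\<dots> \<le> odd_harmonic (Suc n) ^ l * odd_harmonic (Suc n)"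
      using odd_harmonic_ge_1[of n] odd_harmonic_ge_1[of "Suc n"]
      by (intro mult_right_mono power_mono odd_harmonic_mono) auto
    ultimately show ?thesis
      using Suc.IH[of "Suc l"] Suc.IH[of l] by (simp add: Suc mult.commute del: replicate_Suc One_nat_def)
  qed simp
qed

text \<open>The recursion also refers to the limit n + 1 with fewer ones, hence the inner induction
  on \<open>k\<close>.\<close>

lemma t_star_sum_ones_bounds:
  "0 \<le> t_star_sum n (replicate k 1) \<and> t_star_sum n (replicate k 1) \<le> odd_harmonic n ^ k"
proof (induction n arbitrary: k)
  case 0
  show ?case by (cases k) (simp_all add: t_star_sum_0_ones odd_harmonic_def del: replicate_Suc One_nat_def)
next
  case (Suc n)
  show ?case
  proof (induction k)
    case (Suc l)
    have "t_star_sum (Suc n) (replicate (Suc l) 1) =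
        t_star_sum n (replicate (Suc l) 1) + t_star_sum (Suc n) (replicate l 1) / (2 * real n + 1)"
      by (rule t_star_sum_Suc_ones)
    moreover have "\<dots> \<le> odd_harmonic n ^ l * odd_harmonic n + odd_harmonic (Suc n) ^ l / (2 * real n + 1)"
      using Suc.IH \<open>\<And>k. 0 \<le> t_star_sum n (replicate k 1) \<and> t_star_sum n (replicate k 1) \<le> odd_harmonic n ^ k\<close>[of "Suc l"]
      by (intro add_mono divide_right_mono) (auto simp: mult.commute)
    moreover have "\<dots> \<le> odd_harmonic (Suc n) ^ l * odd_harmonic n + odd_harmonic (Suc n) ^ l / (2 * real n + 1)"
      using odd_harmonic_ge_1[of n]
      by (intro add_right_mono mult_right_mono power_mono odd_harmonic_mono) auto
    moreover have "\<dots> = odd_harmonic (Suc n) ^ Suc l"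
      by (simp add: odd_harmonic_Suc algebra_simps)
    ultimately show ?case
      using Suc.IH \<open>\<And>k. 0 \<le> t_star_sum n (replicate k 1) \<and> t_star_sum n (replicate k 1) \<le> odd_harmonic n ^ k\<close>[of "Suc l"]
      by (simp del: replicate_Suc One_nat_def)
  qed simp
qed

lemma t_sum_ones_increment:
  "0 \<le> t_sum (Suc n) (replicate k 1) - t_sum n (replicate k 1)"
  "t_sum (Suc n) (replicate k 1) - t_sum n (replicate k 1) \<le> odd_harmonic n ^ k / (2 * real n + 1)"
proof -
  have "0 \<le> t_sum (Suc n) (replicate k 1) - t_sum n (replicate k 1) \<and>
     t_sum (Suc n) (replicate k 1) - t_sum n (replicate k 1) \<le> odd_harmonic n ^ k / (2 * real n + 1)"
  proof (cases k)
    case (Suc l)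
    have "t_sum n (replicate l 1) \<le> odd_harmonic n ^ k"
      by (rule order_trans[OF conjunct2[OF t_sum_ones_bounds] power_increasing])
         (simp_all add: Suc odd_harmonic_ge_1)
    then show ?thesis
      using t_sum_ones_bounds[of n l] t_sum_Suc_ones[of n l]
      by (simp add: Suc divide_right_mono del: replicate_Suc One_nat_def)
  qed (use odd_harmonic_ge_1[of n] in simp)
  then show "0 \<le> t_sum (Suc n) (replicate k 1) - t_sum n (replicate k 1)"
    "t_sum (Suc n) (replicate k 1) - t_sum n (replicate k 1) \<le> odd_harmonic n ^ k / (2 * real n + 1)"
    by blast+
qed

lemma t_star_sum_ones_increment:
  "0 \<le> t_star_sum (Suc n) (replicate k 1) - t_star_sum n (replicate k 1)"
  "t_star_sum (Suc n) (replicate k 1) - t_star_sum n (replicate k 1) \<le> odd_harmonic (Suc n) ^ k / (2 * real n + 1)"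
proof -
  have "0 \<le> t_star_sum (Suc n) (replicate k 1) - t_star_sum n (replicate k 1) \<and>
     t_star_sum (Suc n) (replicate k 1) - t_star_sum n (replicate k 1) \<le> odd_harmonic (Suc n) ^ k / (2 * real n + 1)"
  proof (cases k)
    case (Suc l)
    have "t_star_sum (Suc n) (replicate l 1) \<le> odd_harmonic (Suc n) ^ k"
      by (rule order_trans[OF conjunct2[OF t_star_sum_ones_bounds] power_increasing])
         (simp_all add: Suc odd_harmonic_ge_1)
    then show ?thesis
      using t_star_sum_ones_bounds[of "Suc n" l] t_star_sum_Suc_ones[of n l]
      by (simp add: Suc divide_right_mono del: replicate_Suc One_nat_def)
  qed (use odd_harmonic_ge_1[of n] in simp)
  then show "0 \<le> t_star_sum (Suc n) (replicate k 1) - t_star_sum n (replicate k 1)"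
    "t_star_sum (Suc n) (replicate k 1) - t_star_sum n (replicate k 1) \<le> odd_harmonic (Suc n) ^ k / (2 * real n + 1)"
    by blast+
qed

text \<open>The increment is split as for a product of two sequences. The argument n + 2 is the
  largest upper limit that occurs, namely in the star sum of \<open>c (Suc n)\<close>.\<close>

lemma t_product_bounds:
  fixes k l :: nat
  defines "c \<equiv> \<lambda>n. t_sum n (replicate k 1) * t_star_sum (n + 1) (replicate l 1)"
  shows "0 \<le> c n" "c n \<le> odd_harmonic (n + 2) ^ (k + l)"
    "\<bar>c (Suc n) - c n\<bar> \<le> 2 * odd_harmonic (n + 2) ^ (k + l) / (2 * real n + 1)"
proof -
  define K where "K = odd_harmonic (n + 2)"
  define t t' s s' where "t = t_sum n (replicate k 1)" and "t' = t_sum (Suc n) (replicate k 1)"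
    and "s = t_star_sum (n + 1) (replicate l 1)" and "s' = t_star_sum (n + 2) (replicate l 1)"
  have K: "odd_harmonic n \<le> K" "odd_harmonic (n + 1) \<le> K" "K \<ge> 1" "odd_harmonic n \<ge> 1" "odd_harmonic (n + 1) \<ge> 1"
    unfolding K_def by (auto intro: odd_harmonic_mono odd_harmonic_ge_1)
  have pow: "odd_harmonic n ^ k \<le> K ^ k" "odd_harmonic (n + 1) ^ l \<le> K ^ l"
    using K by (auto intro!: power_mono)
  have t: "0 \<le> t" "t \<le> K ^ k"
    using t_sum_ones_bounds[of n k] pow unfolding t_def by linarith+
  have s: "0 \<le> s" "s \<le> K ^ l"
    using t_star_sum_ones_bounds[of "n + 1" l] pow unfolding s_def by linarith+
  have s': "0 \<le> s'" "s' \<le> K ^ l"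
    using t_star_sum_ones_bounds[of "n + 2" l] unfolding s'_def K_def by auto
  have dt: "0 \<le> t' - t" "t' - t \<le> K ^ k / (2 * real n + 1)"
  proof -
    show "0 \<le> t' - t" unfolding t_def t'_def by (rule t_sum_ones_increment)
    have "t' - t \<le> odd_harmonic n ^ k / (2 * real n + 1)"
      unfolding t_def t'_def by (rule t_sum_ones_increment)
    also have "\<dots> \<le> K ^ k / (2 * real n + 1)" by (intro divide_right_mono pow) auto
    finally show "t' - t \<le> K ^ k / (2 * real n + 1)" .
  qed
  have ds: "0 \<le> s' - s" "s' - s \<le> K ^ l / (2 * real n + 1)"
  proof -
    show "0 \<le> s' - s" using t_star_sum_ones_increment(1)[of "n + 1" l] unfolding s_def s'_def by simp
    have "s' - s \<le> K ^ l / (2 * real (n + 1) + 1)"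
      using t_star_sum_ones_increment(2)[of "n + 1" l] unfolding s_def s'_def K_def by simp
    also have "\<dots> \<le> K ^ l / (2 * real n + 1)" using K by (intro divide_left_mono) auto
    finally show "s' - s \<le> K ^ l / (2 * real n + 1)" .
  qed
  have c: "c n = t * s" "c (Suc n) = t' * s'"
    by (simp_all add: c_def t_def t'_def s_def s'_def)
  show "0 \<le> c n" unfolding c using t s by simp
  have "t * s \<le> K ^ k * K ^ l" using t s K by (intro mult_mono) auto
  then show "c n \<le> odd_harmonic (n + 2) ^ (k + l)" unfolding c K_def by (simp add: power_add)
  have "c (Suc n) - c n = (t' - t) * s' + t * (s' - s)" unfolding c by (simp add: algebra_simps)
  moreover have "(t' - t) * s' \<le> (K ^ k / (2 * real n + 1)) * K ^ l"
    using dt s' K by (intro mult_mono) auto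
  moreover have "t * (s' - s) \<le> K ^ k * (K ^ l / (2 * real n + 1))"
    using ds t K by (intro mult_mono) auto
  moreover have "0 \<le> (t' - t) * s'" "0 \<le> t * (s' - s)" using dt s' t ds by auto
  ultimately have "\<bar>c (Suc n) - c n\<bar> \<le> (K ^ k / (2 * real n + 1)) * K ^ l + K ^ k * (K ^ l / (2 * real n + 1))"
    by linarith
  also have "\<dots> = 2 * K ^ (k + l) / (2 * real n + 1)" by (simp add: power_add)
  finally show "\<bar>c (Suc n) - c n\<bar> \<le> 2 * odd_harmonic (n + 2) ^ (k + l) / (2 * real n + 1)"
    unfolding K_def .
qed

text \<open>These are the two hypotheses needed for summation by parts against partial sums of size
  sqrt (n + 1). The terms decay like n^(-1/4) and n^(-5/4) respectively.\<close>

lemma t_product_weights: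
  fixes k l :: nat
  defines "b \<equiv> \<lambda>n. t_sum n (replicate k 1) * t_star_sum (n + 1) (replicate l 1) / (2 * real n + 1)"
  shows "(\<lambda>n. b n * sqrt (real n + 1)) \<longlonglongrightarrow> 0"
    "summable (\<lambda>n. \<bar>b n - b (Suc n)\<bar> * sqrt (real n + 1))"
proof -
  obtain C where C: "C > 0" "\<And>n. odd_harmonic (n + 2) ^ (k + l) \<le> C * (real n + 3) powr (1/4)"
    using odd_harmonic_power_bound by blast
  define c where "c = (\<lambda>n. t_sum n (replicate k 1) * t_star_sum (n + 1) (replicate l 1))"
  have b: "b n = c n / (2 * real n + 1)" for n by (simp add: b_def c_def)
  have c: "0 \<le> c n" "c n \<le> C * (real n + 3) powr (1/4)"
    "\<bar>c (Suc n) - c n\<bar> \<le> 2 * (C * (real n + 3) powr (1/4)) / (2 * real n + 1)" for n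
  proof -
    show "0 \<le> c n" unfolding c_def by (rule t_product_bounds)
    show "c n \<le> C * (real n + 3) powr (1/4)"
      using t_product_bounds(2)[of n k l] C(2)[of n] unfolding c_def by linarith
    have "\<bar>c (Suc n) - c n\<bar> \<le> 2 * odd_harmonic (n + 2) ^ (k + l) / (2 * real n + 1)"
      unfolding c_def by (rule t_product_bounds)
    also have "\<dots> \<le> 2 * (C * (real n + 3) powr (1/4)) / (2 * real n + 1)"
      by (intro divide_right_mono mult_left_mono C) auto
    finally show "\<bar>c (Suc n) - c n\<bar> \<le> 2 * (C * (real n + 3) powr (1/4)) / (2 * real n + 1)" .
  qed
  have sq: "sqrt (real n + 1) \<le> (real n + 3) powr (1/2)" for n
    by (simp add: powr_half_sqrt)
  have b0: "b n * sqrt (real n + 1) \<le> 3 * C * (real n + 3) powr (- 1/4)" for n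
  proof -
    have "b n \<le> (C * (real n + 3) powr (1/4)) / ((real n + 3) / 3)"
      unfolding b using c[of n] by (intro frac_le) auto
    also have "\<dots> = 3 * C * (real n + 3) powr (1/4 - 1)"
      unfolding powr_diff by simp
    finally have "b n * sqrt (real n + 1) \<le> 3 * C * (real n + 3) powr (1/4 - 1) * (real n + 3) powr (1/2)"
      using sq[of n] C by (intro mult_mono) auto
    also have "\<dots> = 3 * C * (real n + 3) powr (- 1/4)"
      by (simp add: mult.assoc flip: powr_add)
    finally show ?thesis .
  qed
  have lim: "(\<lambda>n. 3 * C * (real n + 3) powr (- 1/4)) \<longlonglongrightarrow> 0"
  proof -
    have "filterlim (\<lambda>n. real n + 3) at_top sequentially"
      by (rule filterlim_at_top_mono[OF filterlim_real_sequentially]) simp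
    then have "(\<lambda>n. (real n + 3) powr (- 1/4)) \<longlonglongrightarrow> 0"
      by (rule tendsto_neg_powr[rotated]) simp
    then show ?thesis by (rule tendsto_mult_right_zero)
  qed
  show "(\<lambda>n. b n * sqrt (real n + 1)) \<longlonglongrightarrow> 0"
    by (rule tendsto_sandwich[OF _ _ tendsto_const lim])
       (use b0 c(1) in \<open>auto intro!: always_eventually simp: b\<close>)
  show "summable (\<lambda>n. \<bar>b n - b (Suc n)\<bar> * sqrt (real n + 1))"
  proof (rule summable_comparison_test')
    have "summable (\<lambda>n. 12 * C * real (n + 3) powr (- 5/4))"
      by (intro summable_mult summable_ignore_initial_segment) (simp add: summable_real_powr_iff)
    then show "summable (\<lambda>n. 12 * C * (real n + 3) powr (- 5/4))"
      by (simp add: add_ac)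
    fix n :: nat
    define L where "L = real n + 3"
    define M where "M = C * L powr (1/4)"
    have M: "M > 0" using C by (simp add: M_def L_def)
    \<comment> \<open>Separating the change of the denominator from the change of \<open>c\<close>
      leaves two terms, each of order M / n, over one more factor of order n.\<close>
    have "b n - b (Suc n) = (2 * c n / (2 * real n + 1) - (c (Suc n) - c n)) / (2 * real n + 3)"
      unfolding b by (simp add: divide_simps) (simp add: algebra_simps)
    also have "\<bar>\<dots>\<bar> \<le> (2 * M / (2 * real n + 1) + 2 * M / (2 * real n + 1)) / (2 * real n + 3)"
    proof -
      have "0 \<le> 2 * c n / (2 * real n + 1)" "2 * c n / (2 * real n + 1) \<le> 2 * M / (2 * real n + 1)"
        using c(1,2)[of n] unfolding M_def L_def by (auto intro!: divide_right_mono)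
      then have "\<bar>2 * c n / (2 * real n + 1) - (c (Suc n) - c n)\<bar> \<le> 2 * M / (2 * real n + 1) + 2 * M / (2 * real n + 1)"
        using c(3)[of n] unfolding M_def L_def by linarith
      from divide_right_mono[OF this, of "2 * real n + 3"] show ?thesis
        by (simp add: abs_divide)
    qed
    also have "\<dots> = 4 * M / ((2 * real n + 1) * (2 * real n + 3))"
      by (simp flip: add_divide_distrib)
    also have "\<dots> \<le> 4 * M / ((L / 3) * L)"
      using M by (intro divide_left_mono mult_mono) (auto simp: L_def)
    also have "\<dots> = 12 * C * L powr (1/4 - 2)"
      unfolding M_def powr_diff by (simp add: L_def power2_eq_square)
    finally have "\<bar>b n - b (Suc n)\<bar> * sqrt (real n + 1) \<le> 12 * C * L powr (1/4 - 2) * L powr (1/2)"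
      using sq[of n] C by (intro mult_mono) (auto simp: L_def)
    also have "\<dots> = 12 * C * L powr (- 5/4)"
      by (simp add: mult.assoc flip: powr_add)
    finally show "norm (\<bar>b n - b (Suc n)\<bar> * sqrt (real n + 1)) \<le> 12 * C * (real n + 3) powr (- 5/4)"
      by (simp add: L_def)
  qed
qed

section \<open>Uniform convergence of the weighted series\<close>

lemma summation_by_parts:
  fixes b s :: "nat \<Rightarrow> 'a :: comm_ring"
  shows "(\<Sum>n<Suc N. b n * s n) = b N * (\<Sum>k\<le>N. s k) + (\<Sum>n<N. (b n - b (Suc n)) * (\<Sum>k\<le>n. s k))"
  by (induction N) (simp_all add: algebra_simps)

text \<open>The weight is x v^2 with v^2 = x (1 - x). The factor x removes the denominator 1 + y =
  2x of the closed form, one v feeds Bernstein's bound, and the other v is at most 1.\<close>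

lemma weighted_legendre_alternating_sum_bound:
  assumes x: "x \<in> {0..1}"
  shows "\<bar>x\<^sup>2 * (1 - x) * (\<Sum>k\<le>n. (-1) ^ k * (2 * real k + 1) * poly (legendre k) (2 * x - 1))\<bar>
     \<le> sqrt (real n + 1)"
proof -
  define y where "y = 2 * x - 1"
  define S where "S = (\<Sum>k\<le>n. (-1) ^ k * (2 * real k + 1) * poly (legendre k) y)"
  define v where "v = sqrt (x * (1 - x))"
  have y: "-1 \<le> y" "y \<le> 1" using x by (auto simp: y_def)
  have y2: "1 - y\<^sup>2 = 4 * (x * (1 - x))" by (simp add: y_def power2_eq_square algebra_simps)
  have v: "0 \<le> v" "v \<le> 1" "v\<^sup>2 = x * (1 - x)"
  proof -
    have "x * (1 - x) \<le> 1 * 1" using x by (intro mult_mono) auto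
    then show "v \<le> 1" by (simp add: v_def)
  qed (use x in \<open>auto simp: v_def\<close>)
  have P: "v * \<bar>poly (legendre k) y\<bar> \<le> 1 / sqrt (real n + 1)" if "n \<le> k" for k
  proof -
    have "(1 - y\<^sup>2) * (poly (legendre k) y)\<^sup>2 \<le> 2 / (real k + 1)"
      by (rule legendre_bound[OF y])
    also have "\<dots> \<le> 4 / (real n + 1)" using that by (intro frac_le) auto
    finally have "4 * (v * \<bar>poly (legendre k) y\<bar>)\<^sup>2 \<le> 4 * (1 / (real n + 1))"
      unfolding y2 by (simp add: power_mult_distrib v mult.assoc)
    then have "(v * \<bar>poly (legendre k) y\<bar>)\<^sup>2 \<le> (1 / sqrt (real n + 1))\<^sup>2"
      by (simp add: power_divide)
    then show ?thesis by (rule power2_le_imp_le) simp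
  qed
  have "2 * x * S = (-1) ^ n * (real n + 1) * (poly (legendre n) y + poly (legendre (Suc n)) y)"
    using legendre_alternating_sum[of y n] by (simp add: S_def y_def)
  then have "\<bar>2 * x * S\<bar> = (real n + 1) * \<bar>poly (legendre n) y + poly (legendre (Suc n)) y\<bar>"
    by (simp add: abs_mult power_abs)
  also have "\<dots> \<le> (real n + 1) * (\<bar>poly (legendre n) y\<bar> + \<bar>poly (legendre (Suc n)) y\<bar>)"
    by (intro mult_left_mono abs_triangle_ineq) auto
  finally have "v * \<bar>2 * x * S\<bar> \<le> v * ((real n + 1) * (\<bar>poly (legendre n) y\<bar> + \<bar>poly (legendre (Suc n)) y\<bar>))"
    using v by (intro mult_left_mono)
  also have "\<dots> = (real n + 1) * (v * \<bar>poly (legendre n) y\<bar> + v * \<bar>poly (legendre (Suc n)) y\<bar>)"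
    by (simp add: algebra_simps)
  also have "\<dots> \<le> (real n + 1) * (1 / sqrt (real n + 1) + 1 / sqrt (real n + 1))"
    by (intro mult_left_mono add_mono P) auto
  also have "\<dots> = 2 * sqrt (real n + 1)"
    by (simp add: field_simps flip: real_sqrt_mult)
  finally have vS: "v * \<bar>x * S\<bar> \<le> sqrt (real n + 1)"
    by (simp add: abs_mult)
  have "\<bar>x\<^sup>2 * (1 - x) * S\<bar> = v\<^sup>2 * \<bar>x * S\<bar>"
  proof -
    have "x\<^sup>2 * (1 - x) * S = v\<^sup>2 * (x * S)" unfolding v(3) by (simp add: power2_eq_square algebra_simps)
    then show ?thesis by (simp only: abs_mult abs_power2)
  qed
  also have "\<dots> = v * (v * \<bar>x * S\<bar>)" by (simp add: power2_eq_square)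
  also have "\<dots> \<le> 1 * sqrt (real n + 1)"
    using v vS by (intro mult_mono) auto
  finally show ?thesis unfolding S_def y_def by simp
qed

text \<open>
  The weight \<open>x\<^sup>2 (1 - x)\<close> absorbs the singular behaviour of the series at both end points, so that
  convergence becomes uniform on the whole interval.
\<close>

lemma weighted_alternating_legendre_series_uniform:
  fixes b :: "nat \<Rightarrow> real"
  assumes lim: "(\<lambda>n. b n * sqrt (real n + 1)) \<longlonglongrightarrow> 0"
    and summ: "summable (\<lambda>n. \<bar>b n - b (Suc n)\<bar> * sqrt (real n + 1))"
  obtains u where "uniform_limit {0..1}
    (\<lambda>N x. x\<^sup>2 * (1 - x) * (\<Sum>n<N. b n * ((-1) ^ n * (2 * real n + 1) * poly (legendre n) (2 * x - 1)))) u sequentially"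
proof -
  define w where "w = (\<lambda>x::real. x\<^sup>2 * (1 - x))"
  define S where "S = (\<lambda>n x. \<Sum>k\<le>n. (-1) ^ k * (2 * real k + 1) * poly (legendre k) (2 * x - 1))"
  have wS: "\<bar>w x * S n x\<bar> \<le> sqrt (real n + 1)" if "x \<in> {0..1}" for x n
    unfolding w_def S_def by (rule weighted_legendre_alternating_sum_bound[OF that])
  \<comment> \<open>Of the two parts left by summation by parts, the boundary term tends to 0
    uniformly, and the remaining series converges by the Weierstrass M-test.\<close>
  have "uniform_limit {0..1} (\<lambda>N x. b N * (w x * S N x)) (\<lambda>_. 0) sequentially"
  proof (rule uniform_limit_null_comparison)
    show "\<forall>\<^sub>F N in sequentially. \<forall>x\<in>{0..1}. norm (b N * (w x * S N x)) \<le> \<bar>b N * sqrt (real N + 1)\<bar>"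
      using wS by (auto simp: abs_mult intro!: always_eventually mult_left_mono)
    have "(\<lambda>n. \<bar>b n * sqrt (real n + 1)\<bar>) \<longlonglongrightarrow> 0"
      using tendsto_rabs_zero[OF lim] .
    then show "uniform_limit {0..1} (\<lambda>N x. \<bar>b N * sqrt (real N + 1)\<bar>) (\<lambda>_. 0) sequentially"
      by (auto simp: uniform_limit_iff tendsto_iff)
  qed
  moreover have "uniform_limit {0..1} (\<lambda>N x. \<Sum>n<N. (b n - b (Suc n)) * (w x * S n x))
      (\<lambda>x. \<Sum>n. (b n - b (Suc n)) * (w x * S n x)) sequentially"
    by (rule Weierstrass_m_test[OF _ summ])
       (use wS in \<open>auto simp: abs_mult intro!: mult_left_mono\<close>)
  ultimately have "uniform_limit {0..1}
      (\<lambda>N x. b N * (w x * S N x) + (\<Sum>n<N. (b n - b (Suc n)) * (w x * S n x)))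
      (\<lambda>x. 0 + (\<Sum>n. (b n - b (Suc n)) * (w x * S n x))) sequentially"
    by (rule uniform_limit_add)
  moreover have "b N * (w x * S N x) + (\<Sum>n<N. (b n - b (Suc n)) * (w x * S n x)) =
      w x * (\<Sum>n<Suc N. b n * ((-1) ^ n * (2 * real n + 1) * poly (legendre n) (2 * x - 1)))" for N x
    unfolding summation_by_parts S_def by (simp add: algebra_simps sum_distrib_left)
  ultimately have "uniform_limit {0..1}
      (\<lambda>N x. w x * (\<Sum>n<Suc N. b n * ((-1) ^ n * (2 * real n + 1) * poly (legendre n) (2 * x - 1))))
      (\<lambda>x. 0 + (\<Sum>n. (b n - b (Suc n)) * (w x * S n x))) sequentially"
    by (simp only:)
  then have "uniform_limit {0..1}
      (\<lambda>N x. w x * (\<Sum>n<N. b n * ((-1) ^ n * (2 * real n + 1) * poly (legendre n) (2 * x - 1))))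
      (\<lambda>x. 0 + (\<Sum>n. (b n - b (Suc n)) * (w x * S n x))) sequentially"
    by (rule filterlim_sequentially_Suc[THEN iffD1])
  then show ?thesis
    unfolding w_def by (rule that)
qed

section \<open>The Fourier--Legendre expansion\<close>

lemma uniform_limit_sum:
  fixes f :: "'i \<Rightarrow> 'a \<Rightarrow> 'b \<Rightarrow> 'c :: real_normed_vector"
  assumes "\<And>i. i \<in> I \<Longrightarrow> uniform_limit X (f i) (l i) F"
  shows "uniform_limit X (\<lambda>n x. \<Sum>i\<in>I. f i n x) (\<lambda>x. \<Sum>i\<in>I. l i x) F"
  using assms
  by (induction I rule: infinite_finite_induct) (simp_all add: uniform_limit_const uniform_limit_add)

lemma moment_fps_monom_mult: "moment_fps b (monom 1 d * p) = moment_fps (b + real d) p"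
proof (induction d arbitrary: b)
  case (Suc d)
  have "monom 1 (Suc d) * p = [:0, 1:] * (monom 1 d * p)"
    by (simp add: monom_Suc)
  then show ?case
    by (simp only: moment_fps_X_mult Suc.IH) (simp add: add_ac)
qed (simp add: monom_0)

text \<open>The finite sum is symmetric in two linear functionals: integration against
  \<open>x ^ d\<close>, and \<open>moment_fps b\<close> at coefficient \<open>m\<close>. Exchanging
  their roles turns it into the second functional applied to the expansion of \<open>x ^ d\<close>,
  which is exact for N > d.\<close>

lemma integral_power_mult_partial_sum:
  assumes "d < N"
  shows "integral {0..1} (\<lambda>x. x ^ d * (\<Sum>n\<le>N. (2 * real n + 1) * (moment_fps b (shifted_legendre n) $ m) *
             poly (shifted_legendre n) x)) = moment_fps b (monom 1 d) $ m"
proof -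
  define a where "a = (\<lambda>n. (2 * real n + 1) * (moment_fps b (shifted_legendre n) $ m))"
  define q where "q = (\<Sum>n\<le>N. smult (a n) (shifted_legendre n))"
  have "(\<lambda>x. x ^ d * (\<Sum>n\<le>N. a n * poly (shifted_legendre n) x)) = poly (monom 1 d * q)"
    by (simp add: fun_eq_iff q_def poly_monom poly_sum)
  then have "integral {0..1} (\<lambda>x. x ^ d * (\<Sum>n\<le>N. a n * poly (shifted_legendre n) x)) = moment_fps 1 (monom 1 d * q) $ 0"
    by (simp only: integral_unique[OF has_integral_poly_01])
  also have "\<dots> = (\<Sum>n\<le>N. a n * (moment_fps (real d + 1) (shifted_legendre n) $ 0))"
    by (simp add: moment_fps_monom_mult q_def moment_fps_sum moment_fps_smult fps_sum_nth add_ac)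
  also have "\<dots> = moment_fps b (\<Sum>n\<le>N. smult ((2 * real n + 1) * (moment_fps (real d + 1) (shifted_legendre n) $ 0)) (shifted_legendre n)) $ m"
    by (simp add: moment_fps_sum moment_fps_smult fps_sum_nth a_def mult_ac)
  also have "(\<Sum>n\<le>N. smult ((2 * real n + 1) * (moment_fps (real d + 1) (shifted_legendre n) $ 0)) (shifted_legendre n)) = monom 1 d"
    by (rule iffD1[OF poly_eq_poly_eq_iff])
       (simp add: fun_eq_iff poly_monom poly_sum power_shifted_legendre_expansion[OF assms])
  finally show ?thesis unfolding a_def .
qed

text \<open>Only the end point 0 needs an argument: there x^(3/2) (ln x)^m tends to 0, and the
  factor x^2 gives the function the value 0.\<close>

lemma continuous_on_weighted_ln_power:
  "continuous_on {0..1} (\<lambda>x::real. ln x ^ m / sqrt x * (x\<^sup>2 * (1 - x)))"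
proof (rule continuous_on_eq_continuous_within[THEN iffD2], rule ballI)
  fix x :: real assume x: "x \<in> {0..1}"
  show "continuous (at x within {0..1}) (\<lambda>x. ln x ^ m / sqrt x * (x\<^sup>2 * (1 - x)))"
  proof (cases "x = 0")
    case True
    have "((\<lambda>x::real. (-1) ^ m * ((x powr (3/2) * (- ln x) ^ m) * (1 - x))) \<longlongrightarrow> (-1) ^ m * (0 * (1 - 0))) (at_right 0)"
      by (intro tendsto_intros powr_mult_ln_power_tendsto_0) auto
    moreover have "\<forall>\<^sub>F x::real in at_right 0. (-1) ^ m * ((x powr (3/2) * (- ln x) ^ m) * (1 - x)) = ln x ^ m / sqrt x * (x\<^sup>2 * (1 - x))"
      using eventually_at_right_less[of 0]
    proof eventually_elim
      case (elim x)
      have "x powr (3/2) = x powr (2 - 1/2)" by simp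
      also have "\<dots> = x\<^sup>2 / sqrt x"
        unfolding powr_diff using elim by (simp add: powr_half_sqrt)
      finally have "x powr (3/2) = x\<^sup>2 / sqrt x" .
      moreover have "(-1) ^ m * (- ln x) ^ m = ln x ^ m"
        by (simp flip: power_mult_distrib)
      moreover have "(-1) ^ m * ((x powr (3/2) * (- ln x) ^ m) * (1 - x)) =
          ((-1) ^ m * (- ln x) ^ m) * (x powr (3/2) * (1 - x))"
        by (simp only: mult_ac)
      ultimately show ?case by simp
    qed
    ultimately have "((\<lambda>x. ln x ^ m / sqrt x * (x\<^sup>2 * (1 - x))) \<longlongrightarrow> 0) (at_right 0)"
      by (simp add: tendsto_cong)
    then have "((\<lambda>x. ln x ^ m / sqrt x * (x\<^sup>2 * (1 - x))) \<longlongrightarrow> 0) (at 0 within {0..1})"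
      by (subst at_within_Icc_at_right) simp_all
    then show ?thesis
      unfolding True continuous_within by simp
  next
    case False
    then have "x > 0" using x by auto
    then have "isCont (\<lambda>x. ln x ^ m / sqrt x * (x\<^sup>2 * (1 - x))) x"
      by (intro continuous_intros) auto
    then show ?thesis by (rule continuous_at_imp_continuous_at_within)
  qed
qed

context
  fixes m :: nat
begin

definition t_coeff :: "nat \<Rightarrow> nat \<Rightarrow> real" where
  "t_coeff k n = (-1) ^ n * t_sum n (replicate k 1) * t_star_sum (n + 1) (replicate (m - k) 1)"

lemma t_coeff_series_uniform:
  obtains u where "uniform_limit {0..1}
    (\<lambda>N x. x\<^sup>2 * (1 - x) * (\<Sum>n<N. t_coeff k n * poly (legendre n) (2 * x - 1))) u sequentially"
proof -
  define b where "b = (\<lambda>n. t_sum n (replicate k 1) * t_star_sum (n + 1) (replicate (m - k) 1) / (2 * real n + 1))"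
  have "(\<lambda>n. b n * sqrt (real n + 1)) \<longlonglongrightarrow> 0" "summable (\<lambda>n. \<bar>b n - b (Suc n)\<bar> * sqrt (real n + 1))"
    unfolding b_def by (rule t_product_weights)+
  then obtain u where u: "uniform_limit {0..1}
    (\<lambda>N x. x\<^sup>2 * (1 - x) * (\<Sum>n<N. b n * ((-1) ^ n * (2 * real n + 1) * poly (legendre n) (2 * x - 1)))) u sequentially"
    by (rule weighted_alternating_legendre_series_uniform)
  have "b n * ((-1) ^ n * (2 * real n + 1) * y) = t_coeff k n * y" for n y
    using of_nat_0_le_iff[of n, where ?'a = real]
    by (simp add: b_def t_coeff_def field_simps del: of_nat_0_le_iff)
  note eq = this
  show ?thesis
    by (rule that) (use u in \<open>simp only: eq\<close>)
qed

text \<open>The weight is non-zero inside the interval, so it can be divided out of the pointwise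
  limit.\<close>

lemma t_coeff_series_sums:
  assumes u: "uniform_limit {0..1}
      (\<lambda>N x. x\<^sup>2 * (1 - x) * (\<Sum>n<N. t_coeff k n * poly (legendre n) (2 * x - 1))) u sequentially"
    and x: "0 < x" "x < 1"
  shows "(\<lambda>n. t_coeff k n * poly (legendre n) (2 * x - 1)) sums (u x / (x\<^sup>2 * (1 - x)))"
proof -
  have "(\<lambda>N. x\<^sup>2 * (1 - x) * (\<Sum>n<N. t_coeff k n * poly (legendre n) (2 * x - 1))) \<longlonglongrightarrow> u x"
    by (rule tendsto_uniform_limitI[OF u]) (use x in auto)
  then have "(\<lambda>N. x\<^sup>2 * (1 - x) * (\<Sum>n<N. t_coeff k n * poly (legendre n) (2 * x - 1)) / (x\<^sup>2 * (1 - x)))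
      \<longlonglongrightarrow> u x / (x\<^sup>2 * (1 - x))"
    by (rule tendsto_divide[OF _ tendsto_const]) (use x in auto)
  then show ?thesis
    unfolding sums_def using x by simp
qed

lemma fourier_legendre_ln_power:
  "set_integrable lborel {0<..<1} (\<lambda>x. ln x ^ m / sqrt x * poly (legendre n) (2 * x - 1))"
  "fourier_legendre_coeff (\<lambda>x. ln x ^ m / sqrt x) n = fact m * ((2 * real n + 1) * (moment_fps (1/2) (shifted_legendre n) $ m))"
  using has_bochner_integral_ln_power_div_sqrt_poly[of m "shifted_legendre n"]
  by (simp_all add: poly_shifted_legendre has_bochner_integral_iff set_integrable_def
      fourier_legendre_coeff_def set_lebesgue_integral_def)

lemma coeff_eq_sum_t_coeff:
  "fact m * ((2 * real n + 1) * (moment_fps (1/2) (shifted_legendre n) $ m)) =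
     (-1) ^ m * fact m * 2 ^ (m + 1) * (\<Sum>k=0..m. t_coeff k n)"
  unfolding coeff_half_shifted_legendre t_coeff_def by simp

lemma ln_power_eq_series:
  assumes x: "0 < x" "x < 1"
  shows "ln x ^ m / sqrt x =
     (-1) ^ m * fact m * 2 ^ (m + 1) * (\<Sum>k=0..m. \<Sum>n. t_coeff k n * poly (legendre n) (2 * x - 1))"
proof -
  define w where "w = (\<lambda>x::real. x\<^sup>2 * (1 - x))"
  define f where "f = (\<lambda>x::real. ln x ^ m / sqrt x)"
  define A :: real where "A = (-1) ^ m * fact m * 2 ^ (m + 1)"
  have "\<forall>k. \<exists>u. uniform_limit {0..1}
      (\<lambda>N x. w x * (\<Sum>n<N. t_coeff k n * poly (legendre n) (2 * x - 1))) u sequentially"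
    using t_coeff_series_uniform unfolding w_def by blast
  \<comment> \<open>Each \<open>k\<close> has its own limit function, so that the result is a finite
    sum of separately convergent series.\<close>
  from choice[OF this] obtain u where "\<forall>k. uniform_limit {0..1}
      (\<lambda>N x. w x * (\<Sum>n<N. t_coeff k n * poly (legendre n) (2 * x - 1))) (u k) sequentially"
    by (rule exE)
  then have u: "uniform_limit {0..1}
      (\<lambda>N x. w x * (\<Sum>n<N. t_coeff k n * poly (legendre n) (2 * x - 1))) (u k) sequentially" for k
    by (rule spec)
  define g where "g = (\<lambda>x. A * (\<Sum>k=0..m. u k x))"
  define a where "a = (\<lambda>n. fact m * ((2 * real n + 1) * (moment_fps (1/2) (shifted_legendre n) $ m)))"
  have a_eq: "a n = A * (\<Sum>k=0..m. t_coeff k n)" for n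
    unfolding a_def A_def by (rule coeff_eq_sum_t_coeff)
  define s where "s = (\<lambda>N x. \<Sum>n<N. a n * poly (shifted_legendre n) x)"
  have "uniform_limit {0..1} (\<lambda>N x. A * (\<Sum>k=0..m. w x * (\<Sum>n<N. t_coeff k n * poly (legendre n) (2 * x - 1)))) g sequentially"
    unfolding g_def
    by (rule bounded_linear.uniform_limit[OF bounded_linear_mult_right], rule uniform_limit_sum, rule u)
  moreover have "A * (\<Sum>k=0..m. w x * (\<Sum>n<N. t_coeff k n * poly (legendre n) (2 * x - 1))) = w x * s N x" for N x
  proof -
    have "w x * s N x = (\<Sum>n<N. \<Sum>k=0..m. A * (w x * (t_coeff k n * poly (legendre n) (2 * x - 1))))"
      by (simp add: s_def a_eq poly_shifted_legendre sum_distrib_left sum_distrib_right mult_ac)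
    also have "\<dots> = A * (\<Sum>k=0..m. w x * (\<Sum>n<N. t_coeff k n * poly (legendre n) (2 * x - 1)))"
      by (subst sum.swap) (simp add: sum_distrib_left)
    finally show ?thesis ..
  qed
  ultimately have ws: "uniform_limit {0..1} (\<lambda>N x. w x * s N x) g sequentially"
    by simp
  have cont_ws: "continuous_on {0..1} (\<lambda>x. w x * s N x)" for N
    unfolding w_def s_def by (intro continuous_intros)
  have cont_g: "continuous_on {0..1} g"
    by (rule uniform_limit_theorem[OF _ ws]) (use cont_ws in auto)
  have cont_fw: "continuous_on {0..1} (\<lambda>x. f x * w x)"
    unfolding f_def w_def by (rule continuous_on_weighted_ln_power)
  have int: "h integrable_on {0..1}" if "continuous_on {0..1} h" for h :: "real \<Rightarrow> real"
    using that by (rule integrable_continuous_interval)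
  have moment: "integral {0..1} (\<lambda>x. x ^ d * (g x - f x * w x)) = 0" for d
  proof -
    \<comment> \<open>The weight is x^2 - x^3, so the d-th moment of the weighted function involves
      the powers d + 2 and d + 3.\<close>
    define M where "M = fact m * (moment_fps (1/2) (monom 1 (d + 2) - monom 1 (d + 3)) $ m)"
    \<comment> \<open>The last summand has index N - 1, which must exceed d + 3 for both powers to
      be expanded exactly.\<close>
    have partial: "integral {0..1} (\<lambda>x. x ^ d * (w x * s N x)) = M" if "d + 5 \<le> N" for N
    proof -
      obtain N' where N': "N = Suc N'" "d + 3 < N'" using \<open>d + 5 \<le> N\<close> by (cases N) auto
      define S where "S = (\<lambda>x. \<Sum>n\<le>N'. (2 * real n + 1) * (moment_fps (1/2) (shifted_legendre n) $ m) *
             poly (shifted_legendre n) x)"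
      have s: "s N x = fact m * S x" for x
        unfolding s_def a_def N' lessThan_Suc_atMost S_def by (simp add: sum_distrib_left mult_ac)
      have cont_S: "continuous_on {0..1} S" unfolding S_def by (intro continuous_intros)
      have "integral {0..1} (\<lambda>x. x ^ d * (w x * s N x)) =
          integral {0..1} (\<lambda>x. fact m * (x ^ (d + 2) * S x - x ^ (d + 3) * S x))"
        by (rule integral_cong) (simp add: s w_def power_add power2_eq_square power3_eq_cube algebra_simps)
      also have "\<dots> = fact m * (integral {0..1} (\<lambda>x. x ^ (d + 2) * S x) - integral {0..1} (\<lambda>x. x ^ (d + 3) * S x))"
        by (simp only: integral_mult_right)
           (subst integral_diff, auto intro!: int continuous_intros cont_S)
      also have "\<dots> = M"
      proof -
        have "integral {0..1} (\<lambda>x. x ^ e * S x) = moment_fps (1/2) (monom 1 e) $ m" if "e < N'" for e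
          unfolding S_def by (rule integral_power_mult_partial_sum[OF that])
        then show ?thesis
          using N' by (simp only: M_def moment_fps_diff fps_sub_nth)
      qed
      finally show ?thesis .
    qed
    have "uniform_limit {0..1} (\<lambda>N x. x ^ d * (w x * s N x)) (\<lambda>x. x ^ d * g x) sequentially"
    proof (rule uniform_lim_mult[OF uniform_limit_const ws])
      show "bounded ((\<lambda>x::real. x ^ d) ` {0..1})"
        by (intro compact_imp_bounded compact_continuous_image continuous_intros) auto
      show "bounded (g ` {0..1})"
        by (intro compact_imp_bounded compact_continuous_image cont_g) auto
    qed
    then obtain I J where IJ: "\<And>N. ((\<lambda>x. x ^ d * (w x * s N x)) has_integral I N) {0..1}"
        "((\<lambda>x. x ^ d * g x) has_integral J) {0..1}" "I \<longlonglongrightarrow> J"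
      by (rule uniform_limit_integral)
         (auto intro!: continuous_on_mult[OF continuous_on_power[OF continuous_on_id] cont_ws])
    \<comment> \<open>The moments of the partial sums are eventually constant, so their limit, the
      moment of \<open>g\<close>, is that constant.\<close>
    have "I N = M" if "d + 5 \<le> N" for N
      using integral_unique[OF IJ(1)[of N]] partial[OF that] by simp
    then have "\<forall>\<^sub>F N in sequentially. I N = M"
      by (rule eventually_sequentiallyI)
    then have "I \<longlonglongrightarrow> M" by (rule tendsto_eventually)
    then have g: "integral {0..1} (\<lambda>x. x ^ d * g x) = M"
      using LIMSEQ_unique[OF IJ(3)] integral_unique[OF IJ(2)] by simp
    have "has_bochner_integral lborel (\<lambda>x. indicator {0<..<1} x *\<^sub>R (f x * poly (monom 1 (d + 2) - monom 1 (d + 3)) x)) M"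
      unfolding f_def M_def by (rule has_bochner_integral_ln_power_div_sqrt_poly)
    moreover have "poly (monom 1 (d + 2) - monom 1 (d + 3)) x = x ^ d * w x" for x
      by (simp add: poly_monom w_def power_add power2_eq_square power3_eq_cube algebra_simps)
    ultimately have "set_integrable lborel {0<..<1} (\<lambda>x. x ^ d * (f x * w x))"
      "(LBINT x:{0<..<1}. x ^ d * (f x * w x)) = M"
      by (simp_all add: has_bochner_integral_iff set_integrable_def set_lebesgue_integral_def mult_ac)
    \<comment> \<open>The Lebesgue integral over the open interval agrees with the Henstock-Kurzweil
      integral over the closed one.\<close>
    then have "integral {0..1} (\<lambda>x. x ^ d * (f x * w x)) = M"
      unfolding integral_open_interval_real using set_borel_integral_eq_integral by metis
    with g show ?thesis
      unfolding right_diff_distrib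
      by (subst integral_diff) (auto intro!: int continuous_intros cont_g cont_fw)
  qed
  have "g x - f x * w x = 0"
    by (rule continuous_on_vanishing_moments[OF _ moment])
       (use x in \<open>auto intro!: continuous_intros cont_g cont_fw\<close>)
  moreover have "w x \<noteq> 0" using x by (simp add: w_def)
  ultimately have "f x = A * (\<Sum>k=0..m. u k x / w x)"
    by (simp add: g_def field_simps flip: sum_divide_distrib)
  moreover have "(\<Sum>n. t_coeff k n * poly (legendre n) (2 * x - 1)) = u k x / w x" for k
    using t_coeff_series_sums[OF u[of k, unfolded w_def] x] unfolding w_def by (rule sums_unique[symmetric])
  ultimately show ?thesis
    by (simp add: f_def A_def)
qed

end

text \<open>The expansion is given in both senses: as the values of the Fourier-Legendre
  coefficients and as pointwise convergence on (0, 1). Summability is asserted separately for each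
  \<open>k\<close>, because \<open>suminf\<close> of a divergent series has no meaningful
  value.\<close>

theorem theorem4p3:
  fixes m :: nat
  shows "(\<forall>n.
            set_integrable lborel {0<..<1}
              (\<lambda>x::real. ln x ^ m / sqrt x * poly (legendre n) (2 * x - 1)) \<and>
            fourier_legendre_coeff (\<lambda>x. ln x ^ m / sqrt x) n =
              (-1) ^ m * fact m * 2 ^ (m + 1) *
              (\<Sum>k=0..m. (-1) ^ n * t_sum n (replicate k 1)
                                  * t_star_sum (n + 1) (replicate (m - k) 1))) \<and>
         (\<forall>x::real. 0 < x \<and> x < 1 \<longrightarrow>
            (\<forall>k\<in>{0..m}. summable (\<lambda>n. (-1) ^ n * t_sum n (replicate k 1)
                * t_star_sum (n + 1) (replicate (m - k) 1) * poly (legendre n) (2 * x - 1))) \<and>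
            ln x ^ m / sqrt x =
              (-1) ^ m * fact m * 2 ^ (m + 1) *
              (\<Sum>k=0..m. \<Sum>n. (-1) ^ n * t_sum n (replicate k 1)
                * t_star_sum (n + 1) (replicate (m - k) 1) * poly (legendre n) (2 * x - 1)))"
proof (intro conjI allI impI ballI)
  fix n
  show "set_integrable lborel {0<..<1} (\<lambda>x::real. ln x ^ m / sqrt x * poly (legendre n) (2 * x - 1))"
    by (rule fourier_legendre_ln_power)
  show "fourier_legendre_coeff (\<lambda>x. ln x ^ m / sqrt x) n =
      (-1) ^ m * fact m * 2 ^ (m + 1) *
      (\<Sum>k=0..m. (-1) ^ n * t_sum n (replicate k 1) * t_star_sum (n + 1) (replicate (m - k) 1))"
    unfolding fourier_legendre_ln_power coeff_eq_sum_t_coeff t_coeff_def ..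
next
  fix x :: real and k :: nat
  assume x: "0 < x \<and> x < 1"
  obtain u where "uniform_limit {0..1}
      (\<lambda>N x. x\<^sup>2 * (1 - x) * (\<Sum>n<N. t_coeff m k n * poly (legendre n) (2 * x - 1))) u sequentially"
    by (rule t_coeff_series_uniform)
  then show "summable (\<lambda>n. (-1) ^ n * t_sum n (replicate k 1)
      * t_star_sum (n + 1) (replicate (m - k) 1) * poly (legendre n) (2 * x - 1))"
    using t_coeff_series_sums x unfolding t_coeff_def by (blast intro: sums_summable)
next
  fix x :: real
  assume "0 < x \<and> x < 1"
  then show "ln x ^ m / sqrt x = (-1) ^ m * fact m * 2 ^ (m + 1) *
      (\<Sum>k=0..m. \<Sum>n. (-1) ^ n * t_sum n (replicate k 1)
        * t_star_sum (n + 1) (replicate (m - k) 1) * poly (legendre n) (2 * x - 1))"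
    using ln_power_eq_series[of x m] unfolding t_coeff_def by blast
qed

end
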